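(* The adversarial two-stage selection problem \textsc{A2ST} under the continuous budgeted uncertainty set $\mathcal{U}^c$, i.e. the problem, for a given $\mathbf{x}\in\Phi_1$, $$\max_{\mathbf{c}\in\mathcal{U}^c}\ \min_{\mathbf{y}\in\Phi_{\mathbf{x}}}\mathbf{c}\mathbf{y},$$ can be solved in $O(n\log n)$ time.
   Context: Let $[n]=\{1,\dots,n\}$ and $p\in[n]$. The input consists of $n$, $p$, a vector $\mathbf{x}\in\Phi_1$, nonnegative item costs $\underline{c}_i\le\overline{c}_i$ with $d_i=\overline{c}_i-\underline{c}_i\ge 0$ for $i\in[n]$, and a budget $\Gamma\ge 0$. Products such as $\mathbf{c}\mathbf{y}$ denote $\sum_{i\in[n]}c_iy_i$. $\Phi_1=\{\mathbf{x}\in\{0,1\}^n:\sum_{i\in[n]}x_i\le p\}$. For $\mathbf{x}\in\Phi_1$, $\Phi_{\mathbf{x}}=\{\mathbf{y}\in\{0,1\}^n:\sum_{i\in[n]}(x_i+y_i)=p,\ x_i+y_i\le 1\ \text{for all } i\in[n]\}$. The continuous budgeted uncertainty set is $\mathcal{U}^c=\{(\underline{c}_i+\delta_i)_{i\in[n]}:\delta_i\in[0,d_i],\ \sum_{i\in[n]}\delta_i\le\Gamma\}$. Running time counts elementary arithmetic operations and comparisons on the input numbers (standard unit-cost model). *)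

theory Defs
  imports Complex_Main "HOL-Library.FuncSet" "HOL-Library.Landau_Symbols"
begin

text \<open>Vectors indexed by $[n]$ are functions on \<open>nat\<close> that are extensional on \<open>{1..n}\<close>.\<close>

definition Phi1 :: "nat \<Rightarrow> nat \<Rightarrow> (nat \<Rightarrow> nat) set" where
  "Phi1 n p = {x \<in> {1..n} \<rightarrow>\<^sub>E {0, 1}. (\<Sum>i\<in>{1..n}. x i) \<le> p}"

definition Phi :: "nat \<Rightarrow> nat \<Rightarrow> (nat \<Rightarrow> nat) \<Rightarrow> (nat \<Rightarrow> nat) set" where
  "Phi n p x = {y \<in> {1..n} \<rightarrow>\<^sub>E {0, 1}.
     (\<Sum>i\<in>{1..n}. x i + y i) = p \<and> (\<forall>i\<in>{1..n}. x i + y i \<le> 1)}"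

definition Uc :: "nat \<Rightarrow> (nat \<Rightarrow> real) \<Rightarrow> (nat \<Rightarrow> real) \<Rightarrow> real \<Rightarrow> (nat \<Rightarrow> real) set" where
  "Uc n cl d \<Gamma> = {(\<lambda>i\<in>{1..n}. cl i + \<delta> i) | \<delta>.
     (\<forall>i\<in>{1..n}. \<delta> i \<in> {0..d i}) \<and> (\<Sum>i\<in>{1..n}. \<delta> i) \<le> \<Gamma>}"

definition min_cost :: "nat \<Rightarrow> nat \<Rightarrow> (nat \<Rightarrow> nat) \<Rightarrow> (nat \<Rightarrow> real) \<Rightarrow> real" where
  "min_cost n p x c = Min ((\<lambda>y. \<Sum>i\<in>{1..n}. c i * real (y i)) ` Phi n p x)"

lemma finite_Phi: "finite (Phi n p x)"
  by (rule finite_subset[of _ "{1..n} \<rightarrow>\<^sub>E {0, 1}"]) (auto simp: Phi_def intro!: finite_PiE)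

lemma Phi_nonempty:
  assumes "p \<le> n" "x \<in> Phi1 n p"
  shows "Phi n p x \<noteq> {}"
proof -
  define X where "X = {i \<in> {1..n}. x i = 1}"
  have x01: "x i = 0 \<or> x i = 1" if "i \<in> {1..n}" for i
    using assms(2) that by (auto simp: Phi1_def PiE_iff)
  have sum_ind: "(\<Sum>i\<in>{1..n}. if i \<in> A then 1 else 0) = card A" if "A \<subseteq> {1..n}" for A :: "nat set"
    using that by (simp add: sum.If_cases Int_absorb1)
  have X_sub: "X \<subseteq> {1..n}" by (auto simp: X_def)
  have sum_x: "(\<Sum>i\<in>{1..n}. x i) = card X"
  proof -
    have "(\<Sum>i\<in>{1..n}. x i) = (\<Sum>i\<in>{1..n}. if i \<in> X then 1 else 0)"
      by (rule sum.cong) (use x01 in \<open>force simp: X_def\<close>)+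
    then show ?thesis using sum_ind[OF X_sub] by metis
  qed
  from X_sub have "card ({1..n} - X) = n - card X"
    by (simp add: card_Diff_subset finite_subset)
  moreover have X_le: "card X \<le> p" using assms(2) sum_x by (simp add: Phi1_def)
  ultimately have "p - card X \<le> card ({1..n} - X)" using assms(1) by simp
  then obtain Y where Y: "Y \<subseteq> {1..n} - X" "card Y = p - card X"
    by (rule obtain_subset_with_card_n)
  define y where "y = (\<lambda>i\<in>{1..n}. if i \<in> Y then 1 else 0 :: nat)"
  have "(\<Sum>i\<in>{1..n}. y i) = p - card X"
    using sum_ind[of Y] Y by (auto simp: y_def)
  then have "(\<Sum>i\<in>{1..n}. x i + y i) = p"
    using sum_x X_le by (simp add: sum.distrib)
  moreover have "x i + y i \<le> 1" if "i \<in> {1..n}" for i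
    using x01[OF that] Y(1) that by (auto simp: y_def X_def)
  moreover have "y \<in> {1..n} \<rightarrow>\<^sub>E {0, 1}" by (auto simp: y_def)
  ultimately show ?thesis unfolding Phi_def by blast
qed

text \<open>
  Unit-cost model: a real RAM, presented as a while language over arrays of natural numbers (used
  for indices and counters) and arrays of real numbers. A scalar is cell 0 of an array. Every
  constant, memory access, arithmetic operation, comparison, Boolean connective, assignment and
  branch costs one time unit. The only real constants are 0 and 1, there is no rounding, and real
  numbers cannot be converted to natural numbers. Subtraction on \<open>nat\<close> is truncated, and division
  of reals by 0 yields 0.
\<close>

type_synonym vname = string

datatype nexp =
    NConst nat
  | NRead vname nexp
  | NAdd nexp nexp
  | NSub nexp nexp

datatype rexp =
    RZero
  | ROne
  | RRead vname nexp
  | RAdd rexp rexp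
  | RSub rexp rexp
  | RMul rexp rexp
  | RDiv rexp rexp

datatype bexp =
    NLess nexp nexp
  | RLess rexp rexp
  | BNot bexp
  | BAnd bexp bexp

datatype com =
    Skip
  | NWrite vname nexp nexp
  | RWrite vname nexp rexp
  | Seq com com
  | Cond bexp com com
  | While bexp com

record state =
  nmem :: "vname \<Rightarrow> nat \<Rightarrow> nat"
  rmem :: "vname \<Rightarrow> nat \<Rightarrow> real"

fun nval :: "nexp \<Rightarrow> state \<Rightarrow> nat" where
  "nval (NConst k) s = k"
| "nval (NRead a e) s = nmem s a (nval e s)"
| "nval (NAdd e f) s = nval e s + nval f s"
| "nval (NSub e f) s = nval e s - nval f s"

fun rval :: "rexp \<Rightarrow> state \<Rightarrow> real" where
  "rval RZero s = 0"
| "rval ROne s = 1"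
| "rval (RRead a e) s = rmem s a (nval e s)"
| "rval (RAdd e f) s = rval e s + rval f s"
| "rval (RSub e f) s = rval e s - rval f s"
| "rval (RMul e f) s = rval e s * rval f s"
| "rval (RDiv e f) s = rval e s / rval f s"

fun bval :: "bexp \<Rightarrow> state \<Rightarrow> bool" where
  "bval (NLess e f) s \<longleftrightarrow> nval e s < nval f s"
| "bval (RLess e f) s \<longleftrightarrow> rval e s < rval f s"
| "bval (BNot b) s \<longleftrightarrow> \<not> bval b s"
| "bval (BAnd b1 b2) s \<longleftrightarrow> bval b1 s \<and> bval b2 s"

fun ncost :: "nexp \<Rightarrow> nat" where
  "ncost (NConst k) = 1"
| "ncost (NRead a e) = 1 + ncost e"
| "ncost (NAdd e f) = 1 + ncost e + ncost f"
| "ncost (NSub e f) = 1 + ncost e + ncost f"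

fun rcost :: "rexp \<Rightarrow> nat" where
  "rcost RZero = 1"
| "rcost ROne = 1"
| "rcost (RRead a e) = 1 + ncost e"
| "rcost (RAdd e f) = 1 + rcost e + rcost f"
| "rcost (RSub e f) = 1 + rcost e + rcost f"
| "rcost (RMul e f) = 1 + rcost e + rcost f"
| "rcost (RDiv e f) = 1 + rcost e + rcost f"

fun bcost :: "bexp \<Rightarrow> nat" where
  "bcost (NLess e f) = 1 + ncost e + ncost f"
| "bcost (RLess e f) = 1 + rcost e + rcost f"
| "bcost (BNot b) = 1 + bcost b"
| "bcost (BAnd b1 b2) = 1 + bcost b1 + bcost b2"

text \<open>\<open>exec P s t s'\<close>: started in \<open>s\<close>, the program \<open>P\<close> halts in \<open>s'\<close> after exactly \<open>t\<close> time units.\<close>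

inductive exec :: "com \<Rightarrow> state \<Rightarrow> nat \<Rightarrow> state \<Rightarrow> bool" where
  Skip: "exec Skip s 1 s"
| NWrite: "exec (NWrite a e f) s (1 + ncost e + ncost f)
    (s\<lparr>nmem := (nmem s)(a := (nmem s a)(nval e s := nval f s))\<rparr>)"
| RWrite: "exec (RWrite a e f) s (1 + ncost e + rcost f)
    (s\<lparr>rmem := (rmem s)(a := (rmem s a)(nval e s := rval f s))\<rparr>)"
| Seq: "exec P s t s' \<Longrightarrow> exec Q s' u s'' \<Longrightarrow> exec (Seq P Q) s (t + u) s''"
| CondTrue: "bval b s \<Longrightarrow> exec P s t s' \<Longrightarrow> exec (Cond b P Q) s (1 + bcost b + t) s'"
| CondFalse: "\<not> bval b s \<Longrightarrow> exec Q s t s' \<Longrightarrow> exec (Cond b P Q) s (1 + bcost b + t) s'"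
| WhileFalse: "\<not> bval b s \<Longrightarrow> exec (While b P) s (1 + bcost b) s"
| WhileTrue: "bval b s \<Longrightarrow> exec P s t s' \<Longrightarrow> exec (While b P) s' u s''
    \<Longrightarrow> exec (While b P) s (1 + bcost b + t + u) s''"

inductive_cases SkipE: "exec Skip s t s'"
inductive_cases NWriteE: "exec (NWrite a e f) s t s'"
inductive_cases RWriteE: "exec (RWrite a e f) s t s'"
inductive_cases SeqE: "exec (Seq P Q) s t s'"
inductive_cases CondE: "exec (Cond b P Q) s t s'"
inductive_cases WhileE: "exec (While b P) s t s'"

lemma exec_deterministic:
  "exec P s t s' \<Longrightarrow> exec P s u s'' \<Longrightarrow> u = t \<and> s'' = s'"
proof (induction arbitrary: u s'' rule: exec.induct)
  case Skip
  then show ?case by (rule SkipE) simp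
next
  case NWrite
  then show ?case by (rule NWriteE) simp
next
  case RWrite
  then show ?case by (rule RWriteE) simp
next
  case Seq
  from Seq.prems show ?case by (rule SeqE) (auto dest: Seq.IH)
next
  case (CondTrue b s P t s' Q)
  from CondTrue.prems obtain t1 where "exec P s t1 s''" "u = 1 + bcost b + t1"
    by (rule CondE) (use CondTrue.hyps(1) in simp_all)
  with CondTrue.IH show ?case by blast
next
  case (CondFalse b s Q t s' P)
  from CondFalse.prems obtain t1 where "exec Q s t1 s''" "u = 1 + bcost b + t1"
    by (rule CondE) (use CondFalse.hyps(1) in simp_all)
  with CondFalse.IH show ?case by blast
next
  case WhileFalse
  from WhileFalse.prems show ?case by (rule WhileE) (use WhileFalse.hyps in simp_all)
next
  case (WhileTrue b s P t s' v s3)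
  from WhileTrue.prems obtain t1 s1 u1 where
    "exec P s t1 s1" "exec (While b P) s1 u1 s''" "u = 1 + bcost b + t1 + u1"
    by (rule WhileE) (use WhileTrue.hyps(1) in simp_all)
  with WhileTrue.IH show ?case by blast
qed

text \<open>All memory cells that do not hold input are initially 0.\<close>

definition input_state ::
  "nat \<Rightarrow> nat \<Rightarrow> (nat \<Rightarrow> nat) \<Rightarrow> (nat \<Rightarrow> real) \<Rightarrow> (nat \<Rightarrow> real) \<Rightarrow> real \<Rightarrow> state" where
  "input_state n p x cl cu \<Gamma> =
    \<lparr>nmem = (\<lambda>a i. if a = ''n'' \<and> i = 0 then n
                   else if a = ''p'' \<and> i = 0 then p
                   else if a = ''x'' \<and> i \<in> {1..n} then x i else 0),
     rmem = (\<lambda>a i. if a = ''Gamma'' \<and> i = 0 then \<Gamma>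
                   else if a = ''cl'' \<and> i \<in> {1..n} then cl i
                   else if a = ''cu'' \<and> i \<in> {1..n} then cu i else 0)\<rparr>"

definition output_value :: "state \<Rightarrow> real" where
  "output_value s = rmem s ''value'' 0"

definition output_scenario :: "nat \<Rightarrow> state \<Rightarrow> nat \<Rightarrow> real" where
  "output_scenario n s = (\<lambda>i\<in>{1..n}. rmem s ''c'' i)"

text \<open>Solving the maximisation problem means returning a maximiser together with the maximum.\<close>

definition solves_A2ST_within :: "com \<Rightarrow> (nat \<Rightarrow> real) \<Rightarrow> bool" where
  "solves_A2ST_within P T \<longleftrightarrow>
    (\<forall>n p x cl cu \<Gamma>.
       p \<in> {1..n} \<longrightarrow> x \<in> Phi1 n p \<longrightarrow>
       (\<forall>i\<in>{1..n}. 0 \<le> cl i \<and> cl i \<le> cu i) \<longrightarrow> 0 \<le> \<Gamma> \<longrightarrow>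
       (\<exists>t s. exec P (input_state n p x cl cu \<Gamma>) t s \<and> real t \<le> T n \<and>
          is_arg_max (min_cost n p x) (\<lambda>c. c \<in> Uc n cl (\<lambda>i. cu i - cl i) \<Gamma>)
            (output_scenario n s) \<and>
          output_value s = min_cost n p x (output_scenario n s)))"

end

theory Submission
  imports Defs "HOL-Real_Asymp.Real_Asymp"
begin

text \<open>
  For fixed costs, the cheapest completion costs $\max_t\, q t - \sum_i w_i (t - c_i)^+$, where
  $w_i = 1 - x_i$ and $q$ is the number of items still to be selected. Maximising over the scenarios
  first, for fixed $t$, leaves a univariate concave function, the minimum of
  $q t - \sum_i w_i (t - \underline{c}_i)^+ + \Gamma$ and $q t - \sum_i w_i (t - \overline{c}_i)^+$.
  After sorting the lower and upper costs, a linear sweep finds a maximiser $t$; spending the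
  budget greedily on raising costs towards $t$ then gives a worst-case scenario.
\<close>

section \<open>Weakest preconditions with running time\<close>

text \<open>No minimax theorem is needed: by duality the inner minimum is itself a maximum over
  \<open>t\<close>, so two maxima are exchanged. The minimum cost of the emitted scenario is then
  squeezed between \<open>F t\<close> from weak duality and \<open>F t\<close> as an upper bound for
  every scenario. For fixed \<open>t\<close>, raising a cost by \<open>\<delta>\<close> raises the
  dual value by at most \<open>\<delta>\<close>, and only while that cost is below \<open>t\<close>.
  Item \<open>i\<close> can thus usefully absorb at most \<open>gain i t\<close>, and the budget
  caps the total; this is \<open>F t = lagrangian cl t + min \<Gamma> (G t)\<close>. The sweep never
  evaluates \<open>F\<close>. Since \<open>G\<close> is nondecreasing, comparing \<open>G t\<close>
  with \<open>\<Gamma>\<close> tells which piece is active, and the weights of the lower and upper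
  costs already passed give the slopes of both pieces. Apart from the start 0 and the costs
  themselves, the only point at which the sweep can stop is the crossing
  \<open>G t = \<Gamma>\<close>, computed with one division. All stages except sorting are linear;
  the sort is iterative because the language has no procedures.\<close>

definition wp :: "com \<Rightarrow> state \<Rightarrow> (nat \<Rightarrow> state \<Rightarrow> bool) \<Rightarrow> bool" where
  "wp P s Q \<longleftrightarrow> (\<exists>t s'. exec P s t s' \<and> Q t s')"

lemma wp_mono:
  "wp P s Q \<Longrightarrow> (\<And>t s'. Q t s' \<Longrightarrow> R t s') \<Longrightarrow> wp P s R"
  unfolding wp_def by blast

text \<open>Determinism of \<open>exec\<close> turns the existential \<open>wp\<close> into an
  equivalence for atomic commands, so that straight-line code can be executed symbolically by the
  simplifier.\<close>

lemma wp_Skip [simp]: "wp Skip s Q \<longleftrightarrow> Q 1 s"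
  unfolding wp_def by (metis exec.Skip exec_deterministic)

lemma wp_NWrite [simp]:
  "wp (NWrite a e f) s Q \<longleftrightarrow>
    Q (1 + ncost e + ncost f) (s\<lparr>nmem := (nmem s)(a := (nmem s a)(nval e s := nval f s))\<rparr>)"
  unfolding wp_def by (metis exec.NWrite exec_deterministic)

lemma wp_RWrite [simp]:
  "wp (RWrite a e f) s Q \<longleftrightarrow>
    Q (1 + ncost e + rcost f) (s\<lparr>rmem := (rmem s)(a := (rmem s a)(nval e s := rval f s))\<rparr>)"
  unfolding wp_def by (metis exec.RWrite exec_deterministic)

lemma wp_Seq [simp]:
  "wp (Seq P1 P2) s Q \<longleftrightarrow> wp P1 s (\<lambda>t s'. wp P2 s' (\<lambda>u. Q (t + u)))"
  unfolding wp_def by (blast intro: exec.Seq elim: SeqE)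

lemma wp_Cond [simp]:
  "wp (Cond b P1 P2) s Q \<longleftrightarrow>
    (if bval b s then wp P1 s (\<lambda>t. Q (1 + bcost b + t)) else wp P2 s (\<lambda>t. Q (1 + bcost b + t)))"
  unfolding wp_def
  using exec.CondTrue[of b s P1 _ _ P2] exec.CondFalse[of b s P2 _ _ P1]
  by (cases "bval b s") (fastforce elim: CondE)+

text \<open>\<open>V\<close> is an amortised bound on the remaining running time; since every iteration takes time,
  it also serves as the termination measure.\<close>

lemma wp_While:
  assumes inv: "I s"
    and step: "\<And>s. I s \<Longrightarrow> bval b s \<Longrightarrow> wp P s (\<lambda>t s'. I s' \<and> 1 + bcost b + t + V s' \<le> V s)"
    and post: "\<And>t s'. I s' \<Longrightarrow> \<not> bval b s' \<Longrightarrow> t \<le> V s + 1 + bcost b \<Longrightarrow> Q t s'"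
  shows "wp (While b P) s Q"
proof -
  have "wp (While b P) s (\<lambda>t s'. I s' \<and> \<not> bval b s' \<and> t \<le> V s + 1 + bcost b)"
    using inv
  proof (induction "V s" arbitrary: s rule: less_induct)
    case less
    show ?case
    proof (cases "bval b s")
      case False
      with less.prems show ?thesis
        unfolding wp_def using exec.WhileFalse[of b s P] by fastforce
    next
      case True
      from step[OF less.prems True] obtain t s' where s': "exec P s t s'" "I s'"
        "1 + bcost b + t + V s' \<le> V s"
        unfolding wp_def by blast
      moreover from s'(3) have "V s' < V s" by simp
      from less.hyps[OF this s'(2)] obtain u s'' where "exec (While b P) s' u s''"
        "I s''" "\<not> bval b s''" "u \<le> V s' + 1 + bcost b"
        unfolding wp_def by blast
      ultimately show ?thesis
        unfolding wp_def using True
        using exec.WhileTrue[of b s P t s' u s'']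
        by (intro exI[of _ "1 + bcost b + t + u"] exI[of _ s'']) simp
    qed
  qed
  then show ?thesis
    by (rule wp_mono) (use post in blast)
qed

abbreviation nvar :: "vname \<Rightarrow> nexp" where
  "nvar v \<equiv> NRead v (NConst 0)"

abbreviation rvar :: "vname \<Rightarrow> rexp" where
  "rvar v \<equiv> RRead v (NConst 0)"

abbreviation nset :: "vname \<Rightarrow> nexp \<Rightarrow> com" where
  "nset v e \<equiv> NWrite v (NConst 0) e"

abbreviation rset :: "vname \<Rightarrow> rexp \<Rightarrow> com" where
  "rset v e \<equiv> RWrite v (NConst 0) e"

abbreviation incr :: "vname \<Rightarrow> com" where
  "incr v \<equiv> nset v (NAdd (nvar v) (NConst 1))"

notation Seq (infixr \<open>;;\<close> 60)

section \<open>Bottom-up merge sort\<close>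

text \<open>Frame condition for sorting. Only indices are moved, so the whole real memory, keys
  included, stays fixed, and changes are tracked by the names of natural-number arrays.\<close>

definition unchanged_except :: "vname set \<Rightarrow> state \<Rightarrow> state \<Rightarrow> bool" where
  "unchanged_except X s s' \<longleftrightarrow> rmem s' = rmem s \<and> (\<forall>v. v \<notin> X \<longrightarrow> nmem s' v = nmem s v)"

lemma unchanged_exceptD:
  "unchanged_except X s s' \<Longrightarrow> rmem s' = rmem s"
  "unchanged_except X s s' \<Longrightarrow> v \<notin> X \<Longrightarrow> nmem s' v = nmem s v"
  by (auto simp: unchanged_except_def)

lemma unchanged_except_refl [simp]: "unchanged_except X s s"
  by (simp add: unchanged_except_def)

lemma unchanged_except_trans:
  "unchanged_except X s s' \<Longrightarrow> unchanged_except Y s' s'' \<Longrightarrow> unchanged_except (X \<union> Y) s s''"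
  by (auto simp: unchanged_except_def)

lemma unchanged_except_mono: "unchanged_except X s s' \<Longrightarrow> X \<subseteq> Y \<Longrightarrow> unchanged_except Y s s'"
  by (auto simp: unchanged_except_def)

lemma unchanged_except_nmem_same [simp]:
  "unchanged_except X s (s'\<lparr>nmem := nmem s'\<rparr>) \<longleftrightarrow> unchanged_except X s s'"
  by (simp add: unchanged_except_def)

text \<open>Together with \<open>unchanged_except_nmem_same\<close> this peels off a chain of
  permitted writes until the original memory appears.\<close>

lemma unchanged_except_upd [simp]:
  "v \<in> X \<Longrightarrow> unchanged_except X s (s'\<lparr>nmem := M(v := f)\<rparr>) \<longleftrightarrow> unchanged_except X s (s'\<lparr>nmem := M\<rparr>)"
  by (auto simp: unchanged_except_def)

section \<open>Merging two adjacent sorted runs\<close>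

definition key_sorted :: "(nat \<Rightarrow> real) \<Rightarrow> (nat \<Rightarrow> nat) \<Rightarrow> nat \<Rightarrow> nat \<Rightarrow> bool" where
  "key_sorted K f lo hi \<longleftrightarrow> (\<forall>i j. lo \<le> i \<longrightarrow> i \<le> j \<longrightarrow> j < hi \<longrightarrow> K (f i) \<le> K (f j))"

text \<open>Ties go to the left run. \<open>BAnd\<close> does not short-circuit, so a head may be
  read beyond its run; memory is total, and the bound test makes the value irrelevant.\<close>

definition merge_loop :: com where
  "merge_loop = While (NLess (nvar ''k'') (nvar ''hi''))
    (Cond (BAnd (NLess (nvar ''a'') (nvar ''mid''))
            (BNot (BAnd (NLess (nvar ''b'') (nvar ''hi''))
              (RLess (RRead ''K'' (NRead ''P'' (nvar ''b''))) (RRead ''K'' (NRead ''P'' (nvar ''a'')))))))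
       (NWrite ''Q'' (nvar ''k'') (NRead ''P'' (nvar ''a'')) ;; incr ''a'')
       (NWrite ''Q'' (nvar ''k'') (NRead ''P'' (nvar ''b'')) ;; incr ''b'') ;;
     incr ''k'')"

text \<open>The equation \<open>k + mid = a + b\<close> says that the output is as long as the two
  consumed prefixes together, without truncated subtraction. Contents are compared as images only:
  in the end \<open>P\<close> maps \<open>n + n\<close> positions onto \<open>n + n\<close> indices,
  and counting recovers injectivity.\<close>

definition merge_inv :: "(nat \<Rightarrow> real) \<Rightarrow> (nat \<Rightarrow> nat) \<Rightarrow> nat \<Rightarrow> nat \<Rightarrow> nat \<Rightarrow>
    nat \<Rightarrow> nat \<Rightarrow> nat \<Rightarrow> (nat \<Rightarrow> nat) \<Rightarrow> bool" where
  "merge_inv K P lo mid hi a b k Q \<longleftrightarrow>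
    lo \<le> a \<and> a \<le> mid \<and> mid \<le> b \<and> b \<le> hi \<and> k + mid = a + b \<and>
    Q ` {lo..<k} = P ` {lo..<a} \<union> P ` {mid..<b} \<and>
    key_sorted K Q lo k \<and>
    (\<forall>j\<in>{lo..<k}. \<forall>r\<in>{a..<mid} \<union> {b..<hi}. K (Q j) \<le> K (P r))"

lemma key_sorted_snoc:
  assumes "key_sorted K f lo k" "\<And>j. j \<in> {lo..<k} \<Longrightarrow> K (f j) \<le> K v"
  shows "key_sorted K (f(k := v)) lo (Suc k)"
  using assms by (auto simp: key_sorted_def less_Suc_eq)

lemma key_sortedD:
  "key_sorted K f lo hi \<Longrightarrow> lo \<le> i \<Longrightarrow> i \<le> j \<Longrightarrow> j < hi \<Longrightarrow> K (f i) \<le> K (f j)"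
  by (auto simp: key_sorted_def)

text \<open>Each head is least in the rest of its own run, so comparing the heads makes
  \<open>P a\<close> least among everything left. This gives both sortedness of the output and the
  last clause of the invariant. The comparison is conditional because the right run may be
  exhausted.\<close>

lemma merge_inv_step_left:
  assumes inv: "merge_inv K P lo mid hi a b k Q"
    and sorted: "key_sorted K P lo mid" "key_sorted K P mid hi"
    and a: "a < mid" and le: "b < hi \<Longrightarrow> K (P a) \<le> K (P b)"
  shows "merge_inv K P lo mid hi (Suc a) b (Suc k) (Q(k := P a))"
proof -
  note I = inv[unfolded merge_inv_def]
  have "lo \<le> k" using I by linarith
  have min: "K (P a) \<le> K (P r)" if "r \<in> {a..<mid} \<union> {b..<hi}" for r
  proof (cases "r < mid")
    case True
    then show ?thesis using that I by (intro key_sortedD[OF sorted(1)]) auto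
  next
    case False
    then have "b < hi" "b \<le> r" "r < hi" using that by auto
    then show ?thesis using I le key_sortedD[OF sorted(2), of b r] by force
  qed
  have "key_sorted K (Q(k := P a)) lo (Suc k)"
    using I a by (intro key_sorted_snoc) auto
  moreover have "(Q(k := P a)) ` {lo..<Suc k} = P ` {lo..<Suc a} \<union> P ` {mid..<b}"
  proof -
    have "(Q(k := P a)) ` {lo..<Suc k} = insert (P a) (Q ` {lo..<k})"
      using \<open>lo \<le> k\<close> by (auto simp: atLeastLessThanSuc)
    then show ?thesis using I by (auto simp: atLeastLessThanSuc)
  qed
  moreover have "\<forall>j\<in>{lo..<Suc k}. \<forall>r\<in>{Suc a..<mid} \<union> {b..<hi}. K ((Q(k := P a)) j) \<le> K (P r)"
    using I min by (auto simp: less_Suc_eq)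
  ultimately show ?thesis
    using I a unfolding merge_inv_def by auto
qed

lemma merge_inv_step_right:
  assumes inv: "merge_inv K P lo mid hi a b k Q"
    and sorted: "key_sorted K P lo mid" "key_sorted K P mid hi"
    and b: "b < hi" and le: "a < mid \<Longrightarrow> K (P b) \<le> K (P a)"
  shows "merge_inv K P lo mid hi a (Suc b) (Suc k) (Q(k := P b))"
proof -
  note I = inv[unfolded merge_inv_def]
  have "lo \<le> k" using I by linarith
  have min: "K (P b) \<le> K (P r)" if "r \<in> {a..<mid} \<union> {b..<hi}" for r
  proof (cases "r < mid")
    case True
    then have "a < mid" "a \<le> r" "lo \<le> a" using that I by auto
    then show ?thesis using le key_sortedD[OF sorted(1), of a r] True by force
  next
    case False
    then show ?thesis using that I by (intro key_sortedD[OF sorted(2)]) auto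
  qed
  have "key_sorted K (Q(k := P b)) lo (Suc k)"
    using I b by (intro key_sorted_snoc) auto
  moreover have "(Q(k := P b)) ` {lo..<Suc k} = P ` {lo..<a} \<union> P ` {mid..<Suc b}"
  proof -
    have "(Q(k := P b)) ` {lo..<Suc k} = insert (P b) (Q ` {lo..<k})"
      using \<open>lo \<le> k\<close> by (auto simp: atLeastLessThanSuc)
    then show ?thesis using I by (auto simp: atLeastLessThanSuc)
  qed
  moreover have "\<forall>j\<in>{lo..<Suc k}. \<forall>r\<in>{a..<mid} \<union> {Suc b..<hi}. K ((Q(k := P b)) j) \<le> K (P r)"
    using I min by (auto simp: less_Suc_eq)
  ultimately show ?thesis
    using I b unfolding merge_inv_def by auto
qed

text \<open>Successive blocks write to the same array \<open>Q\<close>, hence the guarantee for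
  cells below \<open>lo\<close>. The potential charges 100, a generous bound for one iteration, to
  each cell still to be written.\<close>

lemma merge_loop_correct:
  fixes s :: state
  defines "K \<equiv> rmem s ''K''" and "P \<equiv> nmem s ''P''"
    and "lo \<equiv> nmem s ''k'' 0" and "mid \<equiv> nmem s ''mid'' 0" and "hi \<equiv> nmem s ''hi'' 0"
  assumes init: "nmem s ''a'' 0 = lo" "nmem s ''b'' 0 = mid" and le: "lo \<le> mid" "mid \<le> hi"
    and sorted: "key_sorted K P lo mid" "key_sorted K P mid hi"
  shows "wp merge_loop s (\<lambda>t s'. unchanged_except {''Q'', ''a'', ''b'', ''k''} s s' \<and>
    nmem s' ''Q'' ` {lo..<hi} = P ` {lo..<hi} \<and> key_sorted K (nmem s' ''Q'') lo hi \<and>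
    (\<forall>j<lo. nmem s' ''Q'' j = nmem s ''Q'' j) \<and> t \<le> 100 * (hi - lo) + 10)"
  unfolding merge_loop_def
proof (rule wp_While[where V = "\<lambda>s'. 100 * (hi - nmem s' ''k'' 0)" and
    I = "\<lambda>s'. unchanged_except {''Q'', ''a'', ''b'', ''k''} s s' \<and>
      merge_inv K P lo mid hi (nmem s' ''a'' 0) (nmem s' ''b'' 0) (nmem s' ''k'' 0) (nmem s' ''Q'') \<and>
      (\<forall>j<lo. nmem s' ''Q'' j = nmem s ''Q'' j)"], goal_cases)
  case 1
  show ?case
    using init le by (auto simp: unchanged_except_def merge_inv_def key_sorted_def lo_def[symmetric])
next
  case (2 s')
  define a b k where "a = nmem s' ''a'' 0" and "b = nmem s' ''b'' 0" and "k = nmem s' ''k'' 0"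
  from 2 have inv: "merge_inv K P lo mid hi a b k (nmem s' ''Q'')"
    and unch: "unchanged_except {''Q'', ''a'', ''b'', ''k''} s s'"
    and Q: "\<forall>j<lo. nmem s' ''Q'' j = nmem s ''Q'' j"
    by (simp_all add: a_def b_def k_def)
  have eqs: "nmem s' ''P'' = P" "nmem s' ''mid'' 0 = mid" "nmem s' ''hi'' 0 = hi" "rmem s' ''K'' = K"
    using unchanged_exceptD[OF unch] by (simp_all add: P_def mid_def hi_def K_def)
  have "k < hi" using 2 eqs by (simp add: k_def)
  have bnds: "lo \<le> a" "a \<le> mid" "mid \<le> b" "b \<le> hi" "k + mid = a + b"
    using inv by (auto simp: merge_inv_def)
  have "lo \<le> k" using bnds by linarith
  have abk: "nmem s' ''a'' 0 = a" "nmem s' ''b'' 0 = b" "nmem s' ''k'' 0 = k"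
    by (simp_all add: a_def b_def k_def)
  show ?case
  proof (cases "a < mid \<and> (hi \<le> b \<or> K (P a) \<le> K (P b))")
    case True
    then have "merge_inv K P lo mid hi (Suc a) b (Suc k) ((nmem s' ''Q'')(k := P a))"
      by (intro merge_inv_step_left[OF inv sorted]) auto
    with True show ?thesis
      using \<open>lo \<le> k\<close> \<open>k < hi\<close> Q unch by (simp add: eqs abk not_less)
  next
    case False
    \<comment> \<open>If the left run is exhausted, then \<open>a = mid\<close>, and
      \<open>k + mid = a + b\<close> yields \<open>b = k < hi\<close>; otherwise the failed test
      itself gives \<open>b < hi\<close>.\<close>
    then have "merge_inv K P lo mid hi a (Suc b) (Suc k) ((nmem s' ''Q'')(k := P b))"
      using bnds \<open>k < hi\<close> by (intro merge_inv_step_right[OF inv sorted]) auto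
    with False show ?thesis
      using \<open>lo \<le> k\<close> \<open>k < hi\<close> Q unch by (auto simp: eqs abk not_less)
  qed
next
  case (3 t s')
  from 3 have unch: "unchanged_except {''Q'', ''a'', ''b'', ''k''} s s'" by blast
  have "nmem s' ''hi'' 0 = hi"
    using unchanged_exceptD[OF unch] by (simp add: hi_def)
  with 3 have ge: "hi \<le> nmem s' ''k'' 0" by simp
  \<comment> \<open>From \<open>a \<le> mid\<close> and \<open>b \<le> hi\<close> it follows that
    \<open>k = a + b - mid \<le> hi\<close>, with equality only if both runs are consumed.\<close>
  with 3 have k: "nmem s' ''k'' 0 = hi \<and> nmem s' ''a'' 0 = mid \<and> nmem s' ''b'' 0 = hi"
    by (auto simp: merge_inv_def)
  have "{lo..<hi} = {lo..<mid} \<union> {mid..<hi}" using le by auto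
  then have "P ` {lo..<hi} = P ` {lo..<mid} \<union> P ` {mid..<hi}" by (metis image_Un)
  with 3 k show ?case
    by (auto simp: merge_inv_def lo_def)
qed


section \<open>Passes over runs of doubling width\<close>

text \<open>Clipping at \<open>N\<close> handles a ragged tail: if the left run already reaches
  \<open>N\<close>, the right run is empty and merging merely copies.\<close>

definition merge_setup :: com where
  "merge_setup =
    nset ''mid'' (NAdd (nvar ''i'') (nvar ''w'')) ;;
    Cond (NLess (nvar ''N'') (nvar ''mid'')) (nset ''mid'' (nvar ''N'')) Skip ;;
    nset ''hi'' (NAdd (nvar ''mid'') (nvar ''w'')) ;;
    Cond (NLess (nvar ''N'') (nvar ''hi'')) (nset ''hi'' (nvar ''N'')) Skip ;;
    nset ''a'' (nvar ''i'') ;;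
    nset ''b'' (nvar ''mid'') ;;
    nset ''k'' (nvar ''i'')"

definition merge_block :: com where
  "merge_block = merge_setup ;; merge_loop ;; nset ''i'' (nvar ''hi'')"

definition merge_pass :: com where
  "merge_pass =
    nset ''i'' (NConst 0) ;;
    While (NLess (nvar ''i'') (nvar ''N'')) merge_block"

definition copy_back :: com where
  "copy_back =
    nset ''k'' (NConst 0) ;;
    While (NLess (nvar ''k'') (nvar ''N''))
      (NWrite ''P'' (nvar ''k'') (NRead ''Q'' (nvar ''k'')) ;; incr ''k'')"

definition merge_sort :: com where
  "merge_sort =
    nset ''w'' (NConst 1) ;;
    While (NLess (nvar ''w'') (nvar ''N''))
      (merge_pass ;; copy_back ;; nset ''w'' (NAdd (nvar ''w'') (nvar ''w'')))"

text \<open>Runs are the classes of positions with equal quotient by \<open>w\<close>, so a short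
  last run needs no separate treatment. Width 1 imposes nothing, and a width of at least
  \<open>m\<close> means fully sorted.\<close>

definition blocks_sorted :: "(nat \<Rightarrow> real) \<Rightarrow> (nat \<Rightarrow> nat) \<Rightarrow> nat \<Rightarrow> nat \<Rightarrow> bool" where
  "blocks_sorted K f w m \<longleftrightarrow>
    (\<forall>i j. i \<le> j \<longrightarrow> j < m \<longrightarrow> i div w = j div w \<longrightarrow> K (f i) \<le> K (f j))"

lemma blocks_sorted_1: "blocks_sorted K f 1 m"
  by (auto simp: blocks_sorted_def)

lemma blocks_sorted_imp_key_sorted: "blocks_sorted K f w m \<Longrightarrow> m \<le> w \<Longrightarrow> key_sorted K f 0 m"
  by (auto simp: blocks_sorted_def key_sorted_def)

lemma blocks_sorted_segment:
  assumes "blocks_sorted K f w m" "w dvd lo" "hi \<le> lo + w" "hi \<le> m"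
  shows "key_sorted K f lo hi"
  unfolding key_sorted_def
proof (intro allI impI)
  fix i j assume ij: "lo \<le> i" "i \<le> j" "j < hi"
  obtain c where "lo = w * c" using assms(2) by blast
  with ij assms(3) have "i div w = c" "j div w = c" by (auto intro!: div_nat_eqI)
  with ij assms(1,4) show "K (f i) \<le> K (f j)" by (auto simp: blocks_sorted_def)
qed

text \<open>As \<open>lo\<close> is a multiple of \<open>w\<close>, no block straddles it: two
  positions in one block lie both in the old part or both in the new segment.\<close>

lemma blocks_sorted_extend:
  assumes "blocks_sorted K f w lo" "w dvd lo" "key_sorted K g lo hi" "\<And>j. j < lo \<Longrightarrow> g j = f j"
  shows "blocks_sorted K g w hi"
  unfolding blocks_sorted_def
proof (intro allI impI)
  fix i j assume ij: "i \<le> j" "j < hi" "i div w = j div w"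
  obtain c where c: "lo = w * c" using assms(2) by blast
  show "K (g i) \<le> K (g j)"
  proof (cases "j < lo")
    case True
    then show ?thesis using ij assms(1,4) by (auto simp: blocks_sorted_def)
  next
    case False
    have "lo \<le> i"
    proof (rule ccontr)
      assume "\<not> lo \<le> i"
      then have "i < c * w" "0 < w" using c by (auto simp: mult.commute intro: gr0I)
      then have "i div w < c" by (simp add: div_less_iff_less_mult)
      moreover have "c \<le> j div w"
        using False c \<open>0 < w\<close> by (simp add: less_eq_div_iff_mult_less_eq mult.commute)
      ultimately show False using ij(3) by simp
    qed
    then show ?thesis using ij key_sortedD[OF assms(3)] by blast
  qed
qed

lemma merge_block_correct:
  fixes s :: state
  defines "K \<equiv> rmem s ''K''" and "P \<equiv> nmem s ''P''" and "Q \<equiv> nmem s ''Q''"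
    and "lo \<equiv> nmem s ''i'' 0" and "w \<equiv> nmem s ''w'' 0" and "N \<equiv> nmem s ''N'' 0"
  defines "hi \<equiv> min N (lo + w + w)"
  assumes "blocks_sorted K P w N" "w dvd lo" "lo < N"
  shows "wp merge_block s (\<lambda>t s'.
    unchanged_except {''Q'', ''a'', ''b'', ''k'', ''i'', ''mid'', ''hi''} s s' \<and>
    nmem s' ''i'' 0 = hi \<and>
    nmem s' ''Q'' ` {lo..<hi} = P ` {lo..<hi} \<and> key_sorted K (nmem s' ''Q'') lo hi \<and>
    (\<forall>j<lo. nmem s' ''Q'' j = Q j) \<and> t \<le> 100 * (hi - lo) + 100)"
proof -
  define mid where "mid = min N (lo + w)"
  have le: "lo \<le> mid" "mid \<le> hi" "hi \<le> N" "mid \<le> lo + w" "hi \<le> mid + w" "mid \<le> N"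
    using assms by (auto simp: mid_def hi_def)
  have sorted: "key_sorted K P lo mid" "key_sorted K P mid hi"
  proof -
    show "key_sorted K P lo mid"
      using assms le by (intro blocks_sorted_segment[of K P w N]) auto
    show "key_sorted K P mid hi"
    proof (cases "lo + w \<le> N")
      case True
      then show ?thesis
        using assms le by (intro blocks_sorted_segment[of K P w N]) (auto simp: mid_def)
    next
      case False
      then show ?thesis by (auto simp: key_sorted_def mid_def hi_def)
    qed
  qed
  let ?pre = "\<lambda>t s'. t \<le> 80 \<and> unchanged_except {''mid'', ''hi'', ''a'', ''b'', ''k''} s s' \<and>
    nmem s' ''k'' 0 = lo \<and> nmem s' ''a'' 0 = lo \<and> nmem s' ''mid'' 0 = mid \<and>
    nmem s' ''b'' 0 = mid \<and> nmem s' ''hi'' 0 = hi"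
  have pre: "wp merge_setup s ?pre"
    using \<open>lo < N\<close> unfolding merge_setup_def lo_def N_def w_def mid_def hi_def
    by (simp add: min_def)
  have loop: "wp (merge_loop ;; nset ''i'' (nvar ''hi'')) s1 (\<lambda>t s'.
      unchanged_except {''Q'', ''a'', ''b'', ''k'', ''i'', ''mid'', ''hi''} s s' \<and>
      nmem s' ''i'' 0 = hi \<and>
      nmem s' ''Q'' ` {lo..<hi} = P ` {lo..<hi} \<and> key_sorted K (nmem s' ''Q'') lo hi \<and>
      (\<forall>j<lo. nmem s' ''Q'' j = Q j) \<and> t \<le> 100 * (hi - lo) + 20)" if pre1: "?pre t1 s1" for t1 :: nat and s1
  proof -
    from pre1 have unch: "unchanged_except {''mid'', ''hi'', ''a'', ''b'', ''k''} s s1" by blast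
    have s1: "nmem s1 ''k'' 0 = lo" "nmem s1 ''a'' 0 = lo" "nmem s1 ''mid'' 0 = mid"
      "nmem s1 ''b'' 0 = mid" "nmem s1 ''hi'' 0 = hi"
      "rmem s1 ''K'' = K" "nmem s1 ''P'' = P" "nmem s1 ''Q'' = Q"
      using pre1 unchanged_exceptD[OF unch] by (simp_all add: K_def P_def Q_def)
    note ml = merge_loop_correct[of s1, unfolded s1, OF refl refl le(1,2) sorted]
    show ?thesis
      unfolding wp_Seq
    proof (rule wp_mono[OF ml], elim conjE)
      fix t s'
      assume unch': "unchanged_except {''Q'', ''a'', ''b'', ''k''} s1 s'"
        and post: "nmem s' ''Q'' ` {lo..<hi} = P ` {lo..<hi}" "key_sorted K (nmem s' ''Q'') lo hi"
          "\<forall>j<lo. nmem s' ''Q'' j = Q j" "t \<le> 100 * (hi - lo) + 10"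
      have "unchanged_except {''Q'', ''a'', ''b'', ''k'', ''i'', ''mid'', ''hi''} s s'"
        using unchanged_except_trans[OF unch unch'] by (rule unchanged_except_mono) auto
      moreover have "nmem s' ''hi'' 0 = hi"
        using unchanged_exceptD[OF unch'] s1 by simp
      ultimately show "wp (nset ''i'' (nvar ''hi'')) s' (\<lambda>u s''.
          unchanged_except {''Q'', ''a'', ''b'', ''k'', ''i'', ''mid'', ''hi''} s s'' \<and>
          nmem s'' ''i'' 0 = hi \<and> nmem s'' ''Q'' ` {lo..<hi} = P ` {lo..<hi} \<and>
          key_sorted K (nmem s'' ''Q'') lo hi \<and> (\<forall>j<lo. nmem s'' ''Q'' j = Q j) \<and>
          t + u \<le> 100 * (hi - lo) + 20)"
        using post by simp
    qed
  qed
  show ?thesis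
    unfolding merge_block_def wp_Seq[of merge_setup]
    by (rule wp_mono[OF pre], rule wp_mono[OF loop], assumption) auto
qed

lemma merge_pass_correct:
  fixes s :: state
  defines "K \<equiv> rmem s ''K''" and "P \<equiv> nmem s ''P''"
    and "w \<equiv> nmem s ''w'' 0" and "N \<equiv> nmem s ''N'' 0"
  assumes sorted: "blocks_sorted K P w N" and "0 < w"
  shows "wp merge_pass s (\<lambda>t s'.
    unchanged_except {''Q'', ''a'', ''b'', ''k'', ''i'', ''mid'', ''hi''} s s' \<and>
    nmem s' ''Q'' ` {..<N} = P ` {..<N} \<and> blocks_sorted K (nmem s' ''Q'') (w + w) N \<and>
    t \<le> 300 * N + 20)"
proof -
  let ?I = "\<lambda>s'. unchanged_except {''Q'', ''a'', ''b'', ''k'', ''i'', ''mid'', ''hi''} s s' \<and>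
    (let i = nmem s' ''i'' 0; Q = nmem s' ''Q'' in
      i \<le> N \<and> (i = N \<or> (w + w) dvd i) \<and> Q ` {..<i} = P ` {..<i} \<and> blocks_sorted K Q (w + w) i)"
  have loop: "wp (While (NLess (nvar ''i'') (nvar ''N'')) merge_block) (s\<lparr>nmem := (nmem s)(''i'' := (nmem s ''i'')(0 := 0))\<rparr>)
     (\<lambda>t s'. unchanged_except {''Q'', ''a'', ''b'', ''k'', ''i'', ''mid'', ''hi''} s s' \<and>
       nmem s' ''Q'' ` {..<N} = P ` {..<N} \<and> blocks_sorted K (nmem s' ''Q'') (w + w) N \<and> t \<le> 300 * N + 10)"
  proof (rule wp_While[where I = ?I and V = "\<lambda>s'. 300 * (N - nmem s' ''i'' 0)"], goal_cases)
    case 1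
    show ?case by (simp add: blocks_sorted_def)
  next
    case (2 s1)
    define lo where "lo = nmem s1 ''i'' 0"
    define hi where "hi = min N (lo + w + w)"
    from 2 have unch: "unchanged_except {''Q'', ''a'', ''b'', ''k'', ''i'', ''mid'', ''hi''} s s1"
      by blast
    have eqs: "rmem s1 ''K'' = K" "nmem s1 ''P'' = P" "nmem s1 ''w'' 0 = w" "nmem s1 ''N'' 0 = N"
      using unchanged_exceptD[OF unch] by (simp_all add: K_def P_def w_def N_def)
    have "lo < N" using 2 eqs by (simp add: lo_def)
    have lo: "(w + w) dvd lo" "nmem s1 ''Q'' ` {..<lo} = P ` {..<lo}"
      "blocks_sorted K (nmem s1 ''Q'') (w + w) lo"
      using 2 \<open>lo < N\<close> by (auto simp: lo_def Let_def)
    have "w dvd lo" using lo(1) by (metis dvd_triv_right dvd_trans mult_2)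
    note block = merge_block_correct[of s1, unfolded eqs lo_def[symmetric] hi_def[symmetric],
      OF sorted \<open>w dvd lo\<close> \<open>lo < N\<close>]
    have hi: "lo < hi" "hi \<le> N" "hi = N \<or> (w + w) dvd hi"
      using \<open>lo < N\<close> \<open>0 < w\<close> lo(1) by (auto simp: hi_def min_def add.assoc)
    show ?case
    proof (rule wp_mono[OF block], elim conjE)
      fix t s2
      assume unch': "unchanged_except {''Q'', ''a'', ''b'', ''k'', ''i'', ''mid'', ''hi''} s1 s2"
        and post: "nmem s2 ''i'' 0 = hi" "nmem s2 ''Q'' ` {lo..<hi} = P ` {lo..<hi}"
          "key_sorted K (nmem s2 ''Q'') lo hi" "\<forall>j<lo. nmem s2 ''Q'' j = nmem s1 ''Q'' j"
          "t \<le> 100 * (hi - lo) + 100"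
      have "unchanged_except {''Q'', ''a'', ''b'', ''k'', ''i'', ''mid'', ''hi''} s s2"
        using unchanged_except_trans[OF unch unch'] by simp
      moreover have "blocks_sorted K (nmem s2 ''Q'') (w + w) hi"
        by (rule blocks_sorted_extend[OF lo(3,1) post(3)]) (use post(4) in blast)
      moreover have "nmem s2 ''Q'' ` {..<hi} = P ` {..<hi}"
      proof -
        have "{..<hi} = {..<lo} \<union> {lo..<hi}" using hi by auto
        moreover have "nmem s2 ''Q'' ` {..<lo} = nmem s1 ''Q'' ` {..<lo}"
          using post(4) by (intro image_cong) auto
        ultimately show ?thesis using lo(2) post(2) by (simp add: image_Un)
      qed
      \<comment> \<open>The merged segment is nonempty, so the fixed cost of the block and of the
        loop test, at most 106, can be charged to its cells; 300 per cell covers this and the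
        merging.\<close>
      moreover have "1 + bcost (NLess (nvar ''i'') (nvar ''N'')) + t + 300 * (N - hi) \<le> 300 * (N - lo)"
        using post(5) hi by simp
      ultimately show "?I s2 \<and> 1 + bcost (NLess (nvar ''i'') (nvar ''N'')) + t +
          300 * (N - nmem s2 ''i'' 0) \<le> 300 * (N - nmem s1 ''i'' 0)"
        using hi post(1) by (simp add: Let_def lo_def[symmetric])
    qed
  next
    case (3 t s')
    then have unch: "unchanged_except {''Q'', ''a'', ''b'', ''k'', ''i'', ''mid'', ''hi''} s s'"
      by blast
    have "nmem s' ''N'' 0 = N" using unchanged_exceptD[OF unch] by (simp add: N_def)
    with 3 have "nmem s' ''i'' 0 = N" by (simp add: Let_def)
    with 3 show ?case by (simp add: Let_def)
  qed
  show ?thesis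
    unfolding merge_pass_def wp_Seq wp_NWrite nval.simps
    by (rule wp_mono[OF loop]) simp
qed

lemma copy_back_correct:
  fixes s :: state
  defines "N \<equiv> nmem s ''N'' 0"
  shows "wp copy_back s (\<lambda>t s'. unchanged_except {''P'', ''k''} s s' \<and>
    (\<forall>j<N. nmem s' ''P'' j = nmem s ''Q'' j) \<and> t \<le> 50 * N + 20)"
proof -
  let ?I = "\<lambda>s'. unchanged_except {''P'', ''k''} s s' \<and> (\<forall>j<nmem s' ''k'' 0. nmem s' ''P'' j = nmem s ''Q'' j)"
  have loop: "wp (While (NLess (nvar ''k'') (nvar ''N''))
      (NWrite ''P'' (nvar ''k'') (NRead ''Q'' (nvar ''k'')) ;; incr ''k''))
      (s\<lparr>nmem := (nmem s)(''k'' := (nmem s ''k'')(0 := 0))\<rparr>)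
     (\<lambda>t s'. ?I s' \<and> N \<le> nmem s' ''k'' 0 \<and> t \<le> 50 * N + 10)"
  proof (rule wp_While[where I = ?I and V = "\<lambda>s'. 50 * (N - nmem s' ''k'' 0)"], goal_cases)
    case 1
    show ?case by simp
  next
    case (2 s1)
    then have unch: "unchanged_except {''P'', ''k''} s s1" by blast
    have "nmem s1 ''N'' 0 = N" "nmem s1 ''Q'' = nmem s ''Q''"
      using unchanged_exceptD[OF unch] by (simp_all add: N_def)
    with 2 show ?case by (auto simp: less_Suc_eq)
  next
    case (3 t s')
    then have unch: "unchanged_except {''P'', ''k''} s s'" by blast
    have "nmem s' ''N'' 0 = N" using unchanged_exceptD[OF unch] by (simp add: N_def)
    with 3 show ?case by simp
  qed
  show ?thesis
    unfolding copy_back_def wp_Seq wp_NWrite nval.simps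
    by (rule wp_mono[OF loop]) auto
qed

section \<open>Number of passes\<close>

text \<open>For positive \<open>w\<close> this is the integer form of the logarithm of
  \<open>N / w\<close> to base 2, rounded up and at least 0. It counts the remaining passes and
  drives the potential of the sort.\<close>

definition doublings :: "nat \<Rightarrow> nat \<Rightarrow> nat" where
  "doublings w N = (LEAST l. N \<le> w * 2 ^ l)"

lemma doublings_double:
  assumes "0 < w" "w < N"
  shows "Suc (doublings (w + w) N) \<le> doublings w N"
proof -
  \<comment> \<open>Some exponent must be admissible before the least one can be used;
    \<open>N\<close> serves, by \<open>N < 2 ^ N\<close>.\<close>
  have "N \<le> w * 2 ^ N"
    using assms by (metis less_exp less_imp_le_nat mult.commute mult_le_mono nat_mult_1 Suc_leI One_nat_def)
  then have *: "N \<le> w * 2 ^ doublings w N"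
    unfolding doublings_def by (rule LeastI)
  with assms have "doublings w N \<noteq> 0" by (intro notI) simp
  then obtain l where l: "doublings w N = Suc l" by (cases "doublings w N") auto
  with * have "N \<le> (w + w) * 2 ^ l" by (simp add: algebra_simps)
  then have "doublings (w + w) N \<le> l" unfolding doublings_def by (rule Least_le)
  with l show ?thesis by simp
qed

lemma doublings_1_le:
  assumes "0 < N"
  shows "real (doublings 1 N) \<le> log 2 (real N) + 1"
proof -
  have "real N = 2 powr log 2 (real N)" using assms by simp
  also have "\<dots> \<le> 2 powr real (nat \<lceil>log 2 (real N)\<rceil>)"
    by (intro powr_mono) (auto intro: real_nat_ceiling_ge)
  also have "\<dots> = real (2 ^ nat \<lceil>log 2 (real N)\<rceil>)" by (simp add: powr_realpow)
  finally have "N \<le> 1 * 2 ^ nat \<lceil>log 2 (real N)\<rceil>" by (simp only: of_nat_le_iff mult_1)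
  then have "doublings 1 N \<le> nat \<lceil>log 2 (real N)\<rceil>" unfolding doublings_def by (rule Least_le)
  moreover have "0 \<le> log 2 (real N)" using assms by simp
  ultimately show ?thesis by linarith
qed

text \<open>One round costs at most \<open>350 * N + 100\<close>: \<open>300 * N + 20\<close> for
  merging, \<open>50 * N + 20\<close> for copying, and the slack pays for the test and for doubling
  the width. The drop of \<open>doublings\<close> releases at least this amount.\<close>

lemma merge_sort_correct:
  fixes s :: state
  defines "K \<equiv> rmem s ''K''" and "P \<equiv> nmem s ''P''" and "N \<equiv> nmem s ''N'' 0"
  shows "wp merge_sort s (\<lambda>t s'.
    unchanged_except {''P'', ''Q'', ''a'', ''b'', ''k'', ''i'', ''mid'', ''hi'', ''w''} s s' \<and>
    nmem s' ''P'' ` {..<N} = P ` {..<N} \<and> key_sorted K (nmem s' ''P'') 0 N \<and>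
    t \<le> (350 * N + 100) * doublings 1 N + 20)"
proof -
  let ?X = "{''P'', ''Q'', ''a'', ''b'', ''k'', ''i'', ''mid'', ''hi'', ''w''}"
  let ?I = "\<lambda>s'. unchanged_except ?X s s' \<and> nmem s' ''P'' ` {..<N} = P ` {..<N} \<and>
    0 < nmem s' ''w'' 0 \<and> blocks_sorted K (nmem s' ''P'') (nmem s' ''w'' 0) N"
  let ?body = "merge_pass ;; copy_back ;; nset ''w'' (NAdd (nvar ''w'') (nvar ''w''))"
  have loop: "wp (While (NLess (nvar ''w'') (nvar ''N'')) ?body)
      (s\<lparr>nmem := (nmem s)(''w'' := (nmem s ''w'')(0 := 1))\<rparr>)
     (\<lambda>t s'. ?I s' \<and> N \<le> nmem s' ''w'' 0 \<and> t \<le> (350 * N + 100) * doublings 1 N + 10)"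
  proof (rule wp_While[where I = ?I and V = "\<lambda>s'. (350 * N + 100) * doublings (nmem s' ''w'' 0) N"],
      goal_cases)
    case 1
    show ?case using blocks_sorted_1 by (simp add: P_def)
  next
    case (2 s1)
    define w where "w = nmem s1 ''w'' 0"
    from 2 have unch: "unchanged_except ?X s s1" by blast
    have eqs: "rmem s1 ''K'' = K" "nmem s1 ''N'' 0 = N"
      using unchanged_exceptD[OF unch] by (simp_all add: K_def N_def)
    from 2 eqs have "0 < w" "w < N" and sorted: "blocks_sorted K (nmem s1 ''P'') w N"
      and image: "nmem s1 ''P'' ` {..<N} = P ` {..<N}"
      by (simp_all add: w_def)
    note pass = merge_pass_correct[of s1, unfolded eqs w_def[symmetric], OF sorted \<open>0 < w\<close>]
    have dbl: "(350 * N + 100) * doublings (w + w) N + (350 * N + 100) \<le> (350 * N + 100) * doublings w N"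
      using mult_le_mono2[OF doublings_double[OF \<open>0 < w\<close> \<open>w < N\<close>], of "350 * N + 100"]
      by (simp add: algebra_simps)
    show ?case
      unfolding wp_Seq
    proof (rule wp_mono[OF pass], elim conjE)
      fix t s2
      assume unch2: "unchanged_except {''Q'', ''a'', ''b'', ''k'', ''i'', ''mid'', ''hi''} s1 s2"
        and Q: "nmem s2 ''Q'' ` {..<N} = nmem s1 ''P'' ` {..<N}"
          "blocks_sorted K (nmem s2 ''Q'') (w + w) N" and t: "t \<le> 300 * N + 20"
      have N2: "nmem s2 ''N'' 0 = N" "nmem s2 ''w'' 0 = w"
        using unchanged_exceptD[OF unch2] by (simp_all add: eqs w_def)
      show "wp copy_back s2 (\<lambda>u s3. wp (nset ''w'' (NAdd (nvar ''w'') (nvar ''w''))) s3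
        (\<lambda>v s'. ?I s' \<and> 1 + bcost (NLess (nvar ''w'') (nvar ''N'')) + (t + (u + v)) +
          (350 * N + 100) * doublings (nmem s' ''w'' 0) N
          \<le> (350 * N + 100) * doublings (nmem s1 ''w'' 0) N))"
      proof (rule wp_mono[OF copy_back_correct], unfold N2, elim conjE)
        fix u s3
        assume unch3: "unchanged_except {''P'', ''k''} s2 s3"
          and copy: "\<forall>j<N. nmem s3 ''P'' j = nmem s2 ''Q'' j" and u: "u \<le> 50 * N + 20"
        have "unchanged_except ?X s s3"
          using unchanged_except_trans[OF unchanged_except_trans[OF unch unch2] unch3]
          by (rule unchanged_except_mono) auto
        moreover have "nmem s3 ''w'' 0 = w" using unchanged_exceptD[OF unch3] N2 by simp
        moreover have "nmem s3 ''P'' ` {..<N} = P ` {..<N}"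
          using copy Q(1) image by (metis (no_types, lifting) image_cong lessThan_iff)
        moreover have "blocks_sorted K (nmem s3 ''P'') (w + w) N"
          using Q(2) copy by (auto simp: blocks_sorted_def)
        ultimately show "wp (nset ''w'' (NAdd (nvar ''w'') (nvar ''w''))) s3
          (\<lambda>v s'. ?I s' \<and> 1 + bcost (NLess (nvar ''w'') (nvar ''N'')) + (t + (u + v)) +
            (350 * N + 100) * doublings (nmem s' ''w'' 0) N
            \<le> (350 * N + 100) * doublings (nmem s1 ''w'' 0) N)"
          using t u dbl \<open>0 < w\<close> by (simp add: w_def[symmetric])
      qed
    qed
  next
    case (3 t s')
    then have unch: "unchanged_except ?X s s'" by blast
    have "nmem s' ''N'' 0 = N" using unchanged_exceptD[OF unch] by (simp add: N_def)
    with 3 show ?case by simp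
  qed
  show ?thesis
    unfolding merge_sort_def wp_Seq wp_NWrite nval.simps
    by (rule wp_mono[OF loop]) (auto intro: blocks_sorted_imp_key_sorted)
qed

section \<open>Lagrangian duality\<close>

locale a2st =
  fixes n p :: nat and x :: "nat \<Rightarrow> nat" and cl cu :: "nat \<Rightarrow> real" and \<Gamma> :: real
  assumes p: "p \<in> {1..n}"
    and x: "x \<in> Phi1 n p"
    and costs: "\<And>i. i \<in> {1..n} \<Longrightarrow> 0 \<le> cl i \<and> cl i \<le> cu i"
    and budget: "0 \<le> \<Gamma>"
begin

definition w :: "nat \<Rightarrow> real" where
  "w i = 1 - real (x i)"

definition q :: real where
  "q = real p - (\<Sum>i=1..n. real (x i))"

text \<open>The cardinality constraint is relaxed with multiplier \<open>t\<close>. The items then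
  decouple, and an available one contributes the smaller of 0 and \<open>c i - t\<close>.\<close>

definition lagrangian :: "(nat \<Rightarrow> real) \<Rightarrow> real \<Rightarrow> real" where
  "lagrangian c t = q * t - (\<Sum>i=1..n. w i * max 0 (t - c i))"

text \<open>The most that raising the cost of item \<open>i\<close> can add to the dual value at
  \<open>t\<close>: the length of the part of \<open>[cl i, cu i]\<close> below \<open>t\<close>, or
  0 if \<open>i\<close> is already chosen by \<open>x\<close>.\<close>

definition gain :: "nat \<Rightarrow> real \<Rightarrow> real" where
  "gain i t = w i * (max 0 (t - cl i) - max 0 (t - cu i))"

definition G :: "real \<Rightarrow> real" where
  "G t = (\<Sum>i=1..n. gain i t)"

definition F :: "real \<Rightarrow> real" where
  "F t = min (lagrangian cl t + \<Gamma>) (lagrangian cu t)"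

lemma x01: "i \<in> {1..n} \<Longrightarrow> x i = 0 \<or> x i = 1"
  using x by (auto simp: Phi1_def PiE_iff)

lemma w01: "i \<in> {1..n} \<Longrightarrow> w i = 0 \<or> w i = 1"
  using x01 by (fastforce simp: w_def)

lemma q_nonneg: "0 \<le> q"
proof -
  have "real (\<Sum>i=1..n. x i) \<le> real p" using x by (simp only: Phi1_def mem_Collect_eq of_nat_le_iff)
  then show ?thesis by (simp add: q_def)
qed

lemma q_le_sum_w: "q \<le> (\<Sum>i=1..n. w i)"
  using p by (simp add: q_def w_def sum_subtractf)

lemma Phi_eq:
  "y \<in> Phi n p x \<longleftrightarrow> y \<in> {1..n} \<rightarrow>\<^sub>E {0, 1} \<and> (\<Sum>i=1..n. real (y i)) = q \<and>
    (\<forall>i\<in>{1..n}. real (y i) \<le> w i)"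
proof -
  have "(\<Sum>i\<in>{1..n}. x i + y i) = p \<longleftrightarrow> real (\<Sum>i\<in>{1..n}. x i + y i) = real p"
    by (simp only: of_nat_eq_iff)
  also have "\<dots> \<longleftrightarrow> (\<Sum>i=1..n. real (y i)) = q"
    by (auto simp: q_def sum.distrib)
  finally have "(\<Sum>i\<in>{1..n}. x i + y i) = p \<longleftrightarrow> (\<Sum>i=1..n. real (y i)) = q" .
  moreover have "x i + y i \<le> 1 \<longleftrightarrow> real (y i) \<le> w i" for i
    unfolding w_def by linarith
  ultimately show ?thesis unfolding Phi_def by auto
qed

text \<open>All feasible \<open>y\<close> have the same cardinality \<open>q\<close>, so shifting
  every cost by \<open>t\<close> shifts the objective by a constant.\<close>

lemma cost_via_threshold:
  assumes "y \<in> Phi n p x"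
  shows "(\<Sum>i=1..n. real (y i) * (t - c i)) = q * t - (\<Sum>i=1..n. c i * real (y i))"
proof -
  have "(\<Sum>i=1..n. real (y i) * (t - c i)) = (\<Sum>i=1..n. real (y i)) * t - (\<Sum>i=1..n. c i * real (y i))"
    by (simp add: sum_distrib_left sum_distrib_right sum_subtractf algebra_simps)
  then show ?thesis using assms by (simp add: Phi_eq)
qed

text \<open>Weak duality: a feasible \<open>y\<close> is dominated by \<open>w\<close>, and
  replacing \<open>t - c i\<close> by its positive part only increases the sum.\<close>

lemma lagrangian_le_cost:
  assumes "y \<in> Phi n p x"
  shows "lagrangian c t \<le> (\<Sum>i=1..n. c i * real (y i))"
proof -
  have "q * t - (\<Sum>i=1..n. c i * real (y i)) = (\<Sum>i=1..n. real (y i) * (t - c i))"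
    using cost_via_threshold[OF assms] by simp
  also have "\<dots> \<le> (\<Sum>i=1..n. w i * max 0 (t - c i))"
  proof (rule sum_mono)
    fix i assume "i \<in> {1..n}"
    with assms have "real (y i) \<le> w i" by (simp add: Phi_eq)
    then have "real (y i) * max 0 (t - c i) \<le> w i * max 0 (t - c i)" by (rule mult_right_mono) simp
    moreover have "real (y i) * (t - c i) \<le> real (y i) * max 0 (t - c i)"
      by (rule mult_left_mono) auto
    ultimately show "real (y i) * (t - c i) \<le> w i * max 0 (t - c i)" by linarith
  qed
  finally show ?thesis by (simp add: lagrangian_def)
qed

lemma min_cost_attained:
  obtains y where "y \<in> Phi n p x" "min_cost n p x c = (\<Sum>i=1..n. c i * real (y i))"
    "\<And>z. z \<in> Phi n p x \<Longrightarrow> (\<Sum>i=1..n. c i * real (y i)) \<le> (\<Sum>i=1..n. c i * real (z i))"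
proof -
  let ?V = "(\<lambda>y. \<Sum>i\<in>{1..n}. c i * real (y i)) ` Phi n p x"
  have "Min ?V \<in> ?V"
    using p x Phi_nonempty[of p n x] finite_Phi by (intro Min_in) auto
  then obtain y where y: "y \<in> Phi n p x" "Min ?V = (\<Sum>i=1..n. c i * real (y i))" by auto
  moreover have "Min ?V \<le> (\<Sum>i=1..n. c i * real (z i))" if "z \<in> Phi n p x" for z
    using that finite_Phi by (intro Min_le) auto
  ultimately show ?thesis by (intro that) (auto simp: min_cost_def)
qed

lemma lagrangian_le_min_cost: "lagrangian c t \<le> min_cost n p x c"
  using min_cost_attained lagrangian_le_cost by metis

text \<open>In an optimal selection no selected item is dearer than an unselected one, so any threshold
  between the two groups is an optimal multiplier.\<close>

lemma min_cost_eq_lagrangian: "\<exists>t. min_cost n p x c = lagrangian c t"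
proof -
  obtain y where y: "y \<in> Phi n p x" and val: "min_cost n p x c = (\<Sum>i=1..n. c i * real (y i))"
    and opt: "\<And>z. z \<in> Phi n p x \<Longrightarrow> (\<Sum>i=1..n. c i * real (y i)) \<le> (\<Sum>i=1..n. c i * real (z i))"
    using min_cost_attained by metis
  have y01: "y i = 0 \<or> y i = 1" if "i \<in> {1..n}" for i
    using y that by (auto simp: Phi_def PiE_iff)
  have yw: "real (y i) \<le> w i" if "i \<in> {1..n}" for i
    using y that by (auto simp: Phi_eq)
  define Y where "Y = {i \<in> {1..n}. y i = 1}"
  have exchange: "c i \<le> c j" if i: "i \<in> Y" and j: "j \<in> {1..n}" "y j = 0" "w j = 1" for i j
  proof -
    define z where "z = y(i := 0, j := 1)"
    have ij: "i \<noteq> j" "i \<in> {1..n}" "y i = 1" using i j by (auto simp: Y_def)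
    \<comment> \<open>Stated for arbitrary coefficients: the constant 1 shows that the swap
      preserves the cardinality, and \<open>c\<close> compares the costs.\<close>
    have sum_z: "(\<Sum>k=1..n. f k * real (z k)) = (\<Sum>k=1..n. f k * real (y k)) - f i + f j"
      for f :: "nat \<Rightarrow> real"
    proof -
      have eq: "f k * real (z k) = f k * real (y k) - (if k = i then f i else 0) + (if k = j then f j else 0)" for k
        using ij j by (auto simp: z_def)
      show ?thesis
        using ij(2) j(1) by (simp add: eq sum.distrib sum_subtractf sum.delta')
    qed
    have "(\<Sum>k=1..n. real (z k)) = q"
      using sum_z[of "\<lambda>_. 1"] y by (simp add: Phi_eq)
    moreover have "z \<in> {1..n} \<rightarrow>\<^sub>E {0, 1}"
      using y ij j unfolding Phi_eq z_def by (auto simp: PiE_iff extensional_def)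
    moreover have "\<forall>k\<in>{1..n}. real (z k) \<le> w k"
      using yw j w01 by (auto simp: z_def) (metis ij(2) atLeastAtMost_iff order.refl zero_le_one)
    ultimately have "z \<in> Phi n p x" by (simp add: Phi_eq)
    from opt[OF this] show ?thesis using sum_z[of c] by simp
  qed
  \<comment> \<open>With nothing selected, \<open>t\<close> only has to lie below all costs;
    otherwise the dearest selected item is a valid threshold by \<open>exchange\<close>.\<close>
  define t where "t = (if Y = {} then Min (c ` {1..n}) else Max (c ` Y))"
  have fin: "finite Y" by (simp add: Y_def)
  have le_t: "c i \<le> t" if "i \<in> Y" for i
    using that fin by (auto simp: t_def)
  have t_le: "t \<le> c j" if j: "j \<in> {1..n}" "y j = 0" "w j = 1" for j
  proof (cases "Y = {}")
    case True
    then show ?thesis using j by (auto simp: t_def)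
  next
    case False
    then have "t \<in> c ` Y" using fin by (simp add: t_def)
    then show ?thesis using exchange j by auto
  qed
  have "w i * max 0 (t - c i) = real (y i) * (t - c i)" if i: "i \<in> {1..n}" for i
  proof (cases "y i = 1")
    case True
    then have "w i = 1" using w01[OF i] yw[OF i] by auto
    then show ?thesis using True le_t[of i] i by (simp add: Y_def max_def)
  next
    case False
    then have "y i = 0" using y01[OF i] by simp
    then show ?thesis using t_le[OF i] w01[OF i] by auto
  qed
  then have "lagrangian c t = q * t - (\<Sum>i=1..n. real (y i) * (t - c i))"
    by (simp add: lagrangian_def)
  also have "\<dots> = (\<Sum>i=1..n. c i * real (y i))"
    using cost_via_threshold[OF y] by simp
  finally show ?thesis using val by metis
qed

section \<open>Maximising over scenarios for a fixed threshold\<close>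

lemma gain_nonneg: "i \<in> {1..n} \<Longrightarrow> 0 \<le> gain i t"
  using w01[of i] costs[of i] by (auto simp: gain_def max_def)

lemma gain_le: "i \<in> {1..n} \<Longrightarrow> gain i t \<le> cu i - cl i"
  using w01[of i] costs[of i] by (auto simp: gain_def max_def)

text \<open>Each difference of hinges is nondecreasing because \<open>cl i \<le> cu i\<close>.
  Hence, as \<open>t\<close> grows, the active piece of \<open>F\<close> can only switch from
  \<open>lagrangian cu\<close> to \<open>lagrangian cl\<close> plus budget, never back.\<close>

lemma G_mono: "s \<le> t \<Longrightarrow> G s \<le> G t"
  unfolding G_def gain_def
proof (intro sum_mono)
  fix i assume "s \<le> t" "i \<in> {1..n}"
  then show "w i * (max 0 (s - cl i) - max 0 (s - cu i)) \<le> w i * (max 0 (t - cl i) - max 0 (t - cu i))"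
    using w01[of i] costs[of i] by (auto simp: max_def)
qed

lemma lagrangian_cu: "lagrangian cu t = lagrangian cl t + G t"
  by (simp add: lagrangian_def G_def gain_def sum_subtractf algebra_simps)

lemma F_eq: "F t = lagrangian cl t + min \<Gamma> (G t)"
  by (simp add: F_def lagrangian_cu min_add_distrib_right)

text \<open>The two pieces bound the dual value for separate reasons: a hinge changes by at most the
  raise of its cost, so the raises add at most \<open>\<Gamma>\<close>; and the dual value is
  monotone in the costs, so \<open>cu\<close> is the other bound.\<close>

lemma lagrangian_le_F:
  assumes "c \<in> Uc n cl (\<lambda>i. cu i - cl i) \<Gamma>"
  shows "lagrangian c t \<le> F t"
proof -
  from assms obtain \<delta> where c: "c = (\<lambda>i\<in>{1..n}. cl i + \<delta> i)"
    and \<delta>: "\<forall>i\<in>{1..n}. \<delta> i \<in> {0..cu i - cl i}" "(\<Sum>i\<in>{1..n}. \<delta> i) \<le> \<Gamma>"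
    unfolding Uc_def by blast
  have ci: "cl i \<le> c i \<and> c i \<le> cu i \<and> c i - cl i = \<delta> i" if "i \<in> {1..n}" for i
    using that bspec[OF \<delta>(1) that] by (auto simp: c)
  have "lagrangian c t - lagrangian cl t = (\<Sum>i=1..n. w i * (max 0 (t - cl i) - max 0 (t - c i)))"
    by (simp add: lagrangian_def sum_subtractf algebra_simps)
  also have "\<dots> \<le> (\<Sum>i=1..n. \<delta> i)"
  proof (rule sum_mono)
    fix i assume "i \<in> {1..n}"
    then show "w i * (max 0 (t - cl i) - max 0 (t - c i)) \<le> \<delta> i"
      using w01[of i] ci[of i] by (auto simp: max_def)
  qed
  finally have "lagrangian c t \<le> lagrangian cl t + \<Gamma>" using \<delta>(2) by linarith
  moreover have "lagrangian c t \<le> lagrangian cu t"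
    unfolding lagrangian_def
  proof (intro diff_left_mono sum_mono)
    fix i assume "i \<in> {1..n}"
    then show "w i * max 0 (t - cu i) \<le> w i * max 0 (t - c i)"
      using w01[of i] ci[of i] by (auto simp: max_def)
  qed
  ultimately show ?thesis by (simp add: F_def)
qed

text \<open>Raises within the gains that total \<open>min \<Gamma> (G t)\<close> give the dual value
  \<open>F t\<close> at \<open>t\<close>. Weak duality bounds the minimum cost from below by it, and
  strong duality with \<open>lagrangian_le_F\<close> bounds that of every scenario from above by the
  maximum \<open>F t\<close>.\<close>

lemma optimal_scenario:
  assumes t: "\<And>u. F u \<le> F t"
    and c: "\<And>i. i \<in> {1..n} \<Longrightarrow> cl i \<le> c i \<and> c i - cl i \<le> gain i t"
    and total: "(\<Sum>i=1..n. c i - cl i) = min \<Gamma> (G t)"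
  defines "c' \<equiv> restrict c {1..n}"
  shows "is_arg_max (min_cost n p x) (\<lambda>c. c \<in> Uc n cl (\<lambda>i. cu i - cl i) \<Gamma>) c'"
    and "min_cost n p x c' = lagrangian c t"
proof -
  have upper: "min_cost n p x c \<le> F t" if c: "c \<in> Uc n cl (\<lambda>i. cu i - cl i) \<Gamma>" for c
    using min_cost_eq_lagrangian[of c] lagrangian_le_F[OF c] t by (metis order_trans)
  have "c i - cl i \<le> cu i - cl i" if "i \<in> {1..n}" for i
    using c[OF that] gain_le[OF that, of t] by linarith
  then have U: "c' \<in> Uc n cl (\<lambda>i. cu i - cl i) \<Gamma>"
    unfolding Uc_def c'_def using c total
    by (intro CollectI exI[of _ "\<lambda>i. c i - cl i"]) auto
  \<comment> \<open>A raise within the gain stays below \<open>t\<close>, so the hinge shrinks by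
    exactly the raise; where \<open>w i = 0\<close> the gain is 0 and so is the raise.\<close>
  have "w i * max 0 (t - c i) = w i * max 0 (t - cl i) - (c i - cl i)" if i: "i \<in> {1..n}" for i
    using w01[OF i] c[OF i] costs[OF i] by (auto simp: gain_def max_def split: if_splits)
  then have "lagrangian c t = q * t - (\<Sum>i=1..n. w i * max 0 (t - cl i) - (c i - cl i))"
    by (simp add: lagrangian_def)
  also have "\<dots> = F t"
    using total by (simp add: F_eq lagrangian_def sum_subtractf)
  finally have lag: "lagrangian c t = F t" .
  have "lagrangian c' t = lagrangian c t"
    by (simp add: lagrangian_def c'_def)
  with lag upper[OF U] lagrangian_le_min_cost[of c' t] show val: "min_cost n p x c' = lagrangian c t"
    by linarith
  show "is_arg_max (min_cost n p x) (\<lambda>c. c \<in> Uc n cl (\<lambda>i. cu i - cl i) \<Gamma>) c'"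
    using U upper val lag by (auto simp: is_arg_max_linorder)
qed

text \<open>The breakpoints of \<open>F\<close> other than the crossing of its two pieces: \<open>cl i\<close> carries the
  index \<open>i\<close> and \<open>cu i\<close> the index \<open>n + i\<close>.\<close>

definition key :: "nat \<Rightarrow> real" where
  "key j = (if j \<le> n then cl j else cu (j - n))"

section \<open>Slopes between consecutive breakpoints\<close>

text \<open>\<open>S\<close> collects the breakpoints already passed. Both inequalities are weak, so
  equal keys can be passed one by one in any order without moving \<open>t\<close>.\<close>

definition separates :: "nat set \<Rightarrow> real \<Rightarrow> bool" where
  "separates S t \<longleftrightarrow> (\<forall>j\<in>S. key j \<le> t) \<and> (\<forall>j\<in>{1..n + n} - S. t \<le> key j)"

text \<open>\<open>q - weight_low S\<close> is the slope of \<open>lagrangian cl\<close> on a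
  stretch separated by \<open>S\<close>; \<open>weight_high\<close> plays the same part for
  \<open>lagrangian cu\<close>.\<close>

definition weight_low :: "nat set \<Rightarrow> real" where
  "weight_low S = (\<Sum>i=1..n. if i \<in> S then w i else 0)"

definition weight_high :: "nat set \<Rightarrow> real" where
  "weight_high S = (\<Sum>i=1..n. if n + i \<in> S then w i else 0)"

lemma separates_between: "separates S s \<Longrightarrow> separates S t \<Longrightarrow> s \<le> u \<Longrightarrow> u \<le> t \<Longrightarrow> separates S u"
  unfolding separates_def by (meson order_trans)

text \<open>The weighted sum of hinges is convex with the weight of \<open>P\<close> as a
  subgradient at \<open>s\<close>, whence the inequality; it is linear until a kink outside
  \<open>P\<close> is passed, whence the equality.\<close>

lemma sum_hinge_diff:
  assumes below: "\<And>i. i \<in> {1..n} \<Longrightarrow> P i \<Longrightarrow> c i \<le> s" and above: "\<And>i. i \<in> {1..n} \<Longrightarrow> \<not> P i \<Longrightarrow> s \<le> c i"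
    and "s \<le> t"
  shows "(\<Sum>i=1..n. if P i then w i else 0) * (t - s) \<le>
      (\<Sum>i=1..n. w i * max 0 (t - c i)) - (\<Sum>i=1..n. w i * max 0 (s - c i))"
    and "(\<And>i. i \<in> {1..n} \<Longrightarrow> \<not> P i \<Longrightarrow> t \<le> c i) \<Longrightarrow>
      (\<Sum>i=1..n. if P i then w i else 0) * (t - s) =
      (\<Sum>i=1..n. w i * max 0 (t - c i)) - (\<Sum>i=1..n. w i * max 0 (s - c i))"
proof -
  have "(if P i then w i else 0) * (t - s) \<le> w i * max 0 (t - c i) - w i * max 0 (s - c i)"
    if "i \<in> {1..n}" for i
    using below[OF that] above[OF that] \<open>s \<le> t\<close> w01[OF that] by (auto simp: max_def)
  then show "(\<Sum>i=1..n. if P i then w i else 0) * (t - s) \<le>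
      (\<Sum>i=1..n. w i * max 0 (t - c i)) - (\<Sum>i=1..n. w i * max 0 (s - c i))"
    unfolding sum_distrib_right sum_subtractf[symmetric] by (rule sum_mono)
  assume above': "\<And>i. i \<in> {1..n} \<Longrightarrow> \<not> P i \<Longrightarrow> t \<le> c i"
  have "(if P i then w i else 0) * (t - s) = w i * max 0 (t - c i) - w i * max 0 (s - c i)"
    if "i \<in> {1..n}" for i
    using below[OF that] above'[OF that] \<open>s \<le> t\<close> by (auto simp: max_def algebra_simps)
  then show "(\<Sum>i=1..n. if P i then w i else 0) * (t - s) =
      (\<Sum>i=1..n. w i * max 0 (t - c i)) - (\<Sum>i=1..n. w i * max 0 (s - c i))"
    unfolding sum_distrib_right sum_subtractf[symmetric] by (rule sum.cong[OF refl])
qed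

lemma separatesD:
  assumes "separates S t" "i \<in> {1..n}"
  shows "i \<in> S \<Longrightarrow> cl i \<le> t" "i \<notin> S \<Longrightarrow> t \<le> cl i"
    "n + i \<in> S \<Longrightarrow> cu i \<le> t" "n + i \<notin> S \<Longrightarrow> t \<le> cu i"
proof -
  have range: "i \<in> {1..n + n}" "n + i \<in> {1..n + n}" and keys: "key i = cl i" "key (n + i) = cu i"
    using assms(2) by (auto simp: key_def)
  show "i \<in> S \<Longrightarrow> cl i \<le> t" "i \<notin> S \<Longrightarrow> t \<le> cl i" "n + i \<in> S \<Longrightarrow> cu i \<le> t" "n + i \<notin> S \<Longrightarrow> t \<le> cu i"
    using assms(1) range unfolding separates_def keys[symmetric] by blast+
qed

text \<open>By concavity the current slope bounds the growth past any number of further breakpoints,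
  which lets a local test certify a global maximum.\<close>

lemma lagrangian_beyond:
  assumes "separates S s" "s \<le> t"
  shows "lagrangian cl t \<le> lagrangian cl s + (q - weight_low S) * (t - s)"
    and "lagrangian cu t \<le> lagrangian cu s + (q - weight_high S) * (t - s)"
  using sum_hinge_diff(1)[of "\<lambda>i. i \<in> S" cl s t] sum_hinge_diff(1)[of "\<lambda>i. n + i \<in> S" cu s t]
    separatesD[OF assms(1)] assms(2)
  by (simp_all add: lagrangian_def weight_low_def weight_high_def algebra_simps)

lemma lagrangian_linear:
  assumes "separates S s" "separates S t" "s \<le> t"
  shows "lagrangian cl t = lagrangian cl s + (q - weight_low S) * (t - s)"
    and "lagrangian cu t = lagrangian cu s + (q - weight_high S) * (t - s)"
  using sum_hinge_diff(2)[of "\<lambda>i. i \<in> S" cl s t] sum_hinge_diff(2)[of "\<lambda>i. n + i \<in> S" cu s t]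
    separatesD[OF assms(1)] separatesD[OF assms(2)] assms(3)
  by (simp_all add: lagrangian_def weight_low_def weight_high_def algebra_simps)

lemma G_linear:
  assumes "separates S s" "separates S t" "s \<le> t"
  shows "G t = G s + (weight_low S - weight_high S) * (t - s)"
  using lagrangian_linear[OF assms] lagrangian_cu[of s] lagrangian_cu[of t]
  by (simp add: algebra_simps)

section \<open>The sweep for a maximiser of \<open>F\<close>\<close>

definition sweep_inv :: "nat set \<Rightarrow> real \<Rightarrow> bool" where
  "sweep_inv S t \<longleftrightarrow> separates S t \<and> (\<forall>u\<le>t. F u \<le> F t)"

text \<open>A piece that is active at \<open>t\<close> no longer rises. This suffices for a maximum
  to the right, because \<open>F\<close> lies below each of its pieces.\<close>

definition sweep_done :: "nat set \<Rightarrow> real \<Rightarrow> bool" where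
  "sweep_done S t \<longleftrightarrow> (q \<le> weight_high S \<and> G t \<le> \<Gamma>) \<or> (q \<le> weight_low S \<and> \<Gamma> \<le> G t)"

text \<open>Costs are nonnegative, so all hinges vanish for \<open>u \<le> 0\<close> and
  \<open>F u = q * u\<close>, which does not decrease as \<open>q\<close> is nonnegative.\<close>

lemma sweep_inv_0: "sweep_inv {} 0"
  unfolding sweep_inv_def
proof (intro conjI allI impI)
  show "separates {} 0"
    unfolding separates_def key_def
  proof (intro conjI ballI)
    fix j assume j: "j \<in> {1..n + n} - {}"
    show "0 \<le> (if j \<le> n then cl j else cu (j - n))"
    proof (cases "j \<le> n")
      case True
      then show ?thesis using j costs[of j] by simp
    next
      case False
      then have "j - n \<in> {1..n}" using j by auto
      from costs[OF this] False show ?thesis by simp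
    qed
  qed simp
  have lag: "lagrangian c u = q * u" if "u \<le> 0" "\<And>i. i \<in> {1..n} \<Longrightarrow> 0 \<le> c i" for c u
    using that by (force simp: lagrangian_def max_def intro!: sum.neutral)
  have "F u = q * u" if "u \<le> 0" for u
  proof -
    have "0 \<le> cl i \<and> 0 \<le> cu i" if "i \<in> {1..n}" for i using costs[OF that] by linarith
    then show ?thesis using that budget lag[of u cl] lag[of u cu] by (simp add: F_def)
  qed
  then show "F u \<le> F 0" if "u \<le> 0" for u
    using that q_nonneg by (simp add: mult_nonneg_nonpos)
qed

text \<open>It is enough that a piece attaining the minimum at the right end \<open>t\<close> does
  not fall: \<open>F u\<close> is at most that piece at \<open>u\<close>, hence at most its value
  \<open>F t\<close>. If neither piece falls, the active one need not be known.\<close>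

lemma sweep_inv_advance:
  assumes inv: "sweep_inv S s" and sep: "separates S t" and "s \<le> t"
    and dir: "(weight_low S \<le> q \<and> weight_high S \<le> q) \<or> (weight_high S \<le> q \<and> G t \<le> \<Gamma>) \<or>
      (weight_low S \<le> q \<and> \<Gamma> \<le> G t)"
  shows "sweep_inv S t"
proof -
  have "F u \<le> F t" if u: "s \<le> u" "u \<le> t" for u
  proof -
    have "separates S u" using inv sep u by (auto simp: sweep_inv_def intro: separates_between)
    note lin = lagrangian_linear[OF this sep u(2)]
    have "weight_low S \<le> q \<Longrightarrow> lagrangian cl u \<le> lagrangian cl t"
      "weight_high S \<le> q \<Longrightarrow> lagrangian cu u \<le> lagrangian cu t"
      using lin u(2) by simp_all
    with dir show ?thesis
      using lagrangian_cu[of t] by (auto simp: F_def)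
  qed
  then have "\<forall>u\<le>t. F u \<le> F t"
    using inv \<open>s \<le> t\<close> unfolding sweep_inv_def by (metis linear order_refl order_trans)
  with sep show ?thesis by (simp add: sweep_inv_def)
qed

lemma sweep_done_optimal:
  assumes "sweep_inv S t" "sweep_done S t"
  shows "F u \<le> F t"
proof (cases "u \<le> t")
  case True
  then show ?thesis using assms by (simp add: sweep_inv_def)
next
  case False
  then have "t \<le> u" by simp
  note lag = lagrangian_beyond[OF _ this, of S]
  have "q \<le> weight_low S \<Longrightarrow> lagrangian cl u \<le> lagrangian cl t"
    "q \<le> weight_high S \<Longrightarrow> lagrangian cu u \<le> lagrangian cu t"
    using lag assms(1) mult_nonpos_nonneg[of "q - weight_low S" "u - t"]
      mult_nonpos_nonneg[of "q - weight_high S" "u - t"] \<open>t \<le> u\<close>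
    by (fastforce simp: sweep_inv_def)+
  then show ?thesis
    using assms(2) lagrangian_cu[of t] by (auto simp: F_def sweep_done_def)
qed

lemma weight_insert_low:
  assumes "j \<in> {1..n}" "j \<notin> S"
  shows "weight_low (insert j S) = weight_low S + w j" "weight_high (insert j S) = weight_high S"
proof -
  have "weight_low (insert j S) = (\<Sum>i=1..n. (if i \<in> S then w i else 0) + (if i = j then w i else 0))"
    unfolding weight_low_def using assms by (intro sum.cong) auto
  then show "weight_low (insert j S) = weight_low S + w j"
    using assms by (simp add: sum.distrib weight_low_def)
  show "weight_high (insert j S) = weight_high S"
    unfolding weight_high_def using assms by (intro sum.cong) auto
qed

lemma weight_insert_high:
  assumes "j \<in> {1..n}" "n + j \<notin> S"
  shows "weight_high (insert (n + j) S) = weight_high S + w j"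
    "weight_low (insert (n + j) S) = weight_low S"
proof -
  have "weight_high (insert (n + j) S) =
      (\<Sum>i=1..n. (if n + i \<in> S then w i else 0) + (if i = j then w i else 0))"
    unfolding weight_high_def using assms by (intro sum.cong) auto
  then show "weight_high (insert (n + j) S) = weight_high S + w j"
    using assms by (simp add: sum.distrib weight_high_def)
  show "weight_low (insert (n + j) S) = weight_low S"
    unfolding weight_low_def using assms by (intro sum.cong) auto
qed

text \<open>Enough items are available, \<open>q\<close> being at most the total weight, so past all
  breakpoints no piece rises. A sweep that is still running therefore has a key left to
  read.\<close>

lemma sweep_done_all: "sweep_done {1..n + n} t"
proof -
  have "weight_low {1..n + n} = (\<Sum>i=1..n. w i)" "weight_high {1..n + n} = (\<Sum>i=1..n. w i)"
    unfolding weight_low_def weight_high_def by (auto intro!: sum.cong)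
  then show ?thesis using q_le_sum_w by (auto simp: sweep_done_def)
qed

lemma sweep_inv_insert:
  "sweep_inv S (key j) \<Longrightarrow> sweep_inv (insert j S) (key j)"
  by (auto simp: sweep_inv_def separates_def)

text \<open>While the sweep runs, no piece active at \<open>s\<close> has stopped rising, and
  \<open>G\<close> is monotone. The one unsafe move is from below the budget to above it when
  \<open>lagrangian cl\<close> has stopped rising, since \<open>F\<close> then peaks in
  between.\<close>

lemma sweep_inv_next:
  assumes inv: "sweep_inv S s" and running: "\<not> sweep_done S s"
    and sep: "separates S t" and "s \<le> t" and "\<not> (q \<le> weight_low S \<and> \<Gamma> < G t)"
  shows "sweep_inv S t"
  using assms G_mono[OF \<open>s \<le> t\<close>]
  by (intro sweep_inv_advance[OF inv sep]) (auto simp: sweep_done_def)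

text \<open>In the unsafe case the peak is where \<open>G\<close> meets the budget, found by
  interpolating the linear \<open>G\<close>. There \<open>G u = \<Gamma>\<close> and
  \<open>q \<le> weight_low S\<close>, so \<open>sweep_done\<close> holds.\<close>

lemma sweep_inv_crossing:
  assumes inv: "sweep_inv S s" and running: "\<not> sweep_done S s"
    and sep: "separates S t" and "s \<le> t" and "q \<le> weight_low S" and "\<Gamma> < G t"
  defines "u \<equiv> s + (\<Gamma> - G s) / (weight_low S - weight_high S)"
  shows "sweep_inv S u" and "G u = \<Gamma>"
proof -
  let ?m = "weight_low S - weight_high S"
  have Gs: "G s < \<Gamma>" "weight_high S < q" using running assms by (auto simp: sweep_done_def)
  have sep_s: "separates S s" using inv by (simp add: sweep_inv_def)
  have lin: "G t = G s + ?m * (t - s)" using G_linear[OF sep_s sep \<open>s \<le> t\<close>] .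
  \<comment> \<open>The slope of \<open>G\<close> is positive since
    \<open>weight_high S < q \<le> weight_low S\<close>, so the division is genuine.\<close>
  have m: "0 < ?m" using assms Gs by simp
  have su: "s \<le> u" using Gs m by (simp add: u_def)
  have "(\<Gamma> - G s) / ?m \<le> t - s"
    using lin \<open>\<Gamma> < G t\<close> m by (simp add: divide_le_eq mult.commute)
  then have ut: "u \<le> t" by (simp add: u_def)
  have sep_u: "separates S u" using separates_between[OF sep_s sep su ut] .
  show "G u = \<Gamma>" using G_linear[OF sep_s sep_u su] m by (simp add: u_def)
  with sep_u su Gs show "sweep_inv S u" by (intro sweep_inv_advance[OF inv]) auto
qed

end

section \<open>The program and its running time\<close>

definition rmin :: "vname \<Rightarrow> rexp \<Rightarrow> com" where
  "rmin v e = Cond (RLess e (rvar v)) (rset v e) Skip"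

definition rmax :: "vname \<Rightarrow> rexp \<Rightarrow> com" where
  "rmax v e = Cond (RLess (rvar v) e) (rset v e) Skip"

text \<open>\<open>e\<close> is evaluated in the test and possibly again in the assignment, hence
  the factor 2. A common time bound joins the branches into one state, so that later proofs do not
  split.\<close>

lemma wp_rmin:
  assumes "\<And>t. t \<le> 8 + 2 * rcost e \<Longrightarrow>
    Q t (s\<lparr>rmem := (rmem s)(v := (rmem s v)(0 := min (rmem s v 0) (rval e s)))\<rparr>)"
  shows "wp (rmin v e) s Q"
proof (cases "rval e s < rmem s v 0")
  case True
  \<comment> \<open>The witness is the exact cost of this branch, in the form to which the
    simplifier reduces it.\<close>
  then show ?thesis using assms[of "Suc (Suc (Suc (Suc (Suc (Suc (rcost e + rcost e))))))"] by (simp add: rmin_def min_def)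
next
  case False
  then have "min (rmem s v 0) (rval e s) = rmem s v 0" by simp
  with False show ?thesis using assms[of "Suc (Suc (Suc (Suc (Suc (rcost e)))))"] by (simp add: rmin_def)
qed

lemma wp_rmax:
  assumes "\<And>t. t \<le> 8 + 2 * rcost e \<Longrightarrow>
    Q t (s\<lparr>rmem := (rmem s)(v := (rmem s v)(0 := max (rmem s v 0) (rval e s)))\<rparr>)"
  shows "wp (rmax v e) s Q"
proof (cases "rmem s v 0 < rval e s")
  case True
  then show ?thesis using assms[of "Suc (Suc (Suc (Suc (Suc (Suc (rcost e + rcost e))))))"] by (simp add: rmax_def max_def)
next
  case False
  then have "max (rmem s v 0) (rval e s) = rmem s v 0" by simp
  with False show ?thesis using assms[of "Suc (Suc (Suc (Suc (Suc (rcost e)))))"] by (simp add: rmax_def)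
qed

text \<open>There is no conversion from natural to real numbers, so the number of items still to be
  selected is accumulated in the real register \<open>q\<close>.\<close>

definition load :: com where
  "load =
    nset ''N'' (NAdd (nvar ''n'') (nvar ''n'')) ;;
    While (NLess (nvar ''k'') (nvar ''n''))
      (NWrite ''P'' (nvar ''k'') (NAdd (nvar ''k'') (NConst 1)) ;;
       NWrite ''P'' (NAdd (nvar ''n'') (nvar ''k''))
         (NAdd (nvar ''n'') (NAdd (nvar ''k'') (NConst 1))) ;;
       incr ''k'' ;;
       RWrite ''K'' (nvar ''k'') (RRead ''cl'' (nvar ''k'')) ;;
       RWrite ''K'' (NAdd (nvar ''n'') (nvar ''k'')) (RRead ''cu'' (nvar ''k'')) ;;
       Cond (NLess (nvar ''p'') (nvar ''k'')) Skip (rset ''q'' (RAdd (rvar ''q'') ROne)) ;;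
       Cond (NLess (NConst 0) (NRead ''x'' (nvar ''k'')))
         (rset ''q'' (RSub (rvar ''q'') ROne) ;;
          RWrite ''W'' (nvar ''k'') RZero ;;
          RWrite ''W'' (NAdd (nvar ''n'') (nvar ''k'')) RZero)
         (RWrite ''W'' (nvar ''k'') ROne ;;
          RWrite ''W'' (NAdd (nvar ''n'') (nvar ''k'')) ROne))"

text \<open>\<open>D\<close> is the change of \<open>G\<close> up to the next key, slope times
  distance. The crossing branch leaves \<open>k\<close> alone: it sets \<open>G\<close> to the
  budget while \<open>q\<close> is at most \<open>nA\<close>, so the next test ends the
  loop.\<close>

definition sweep_step :: com where
  "sweep_step =
    nset ''j'' (NRead ''P'' (nvar ''k'')) ;;
    rset ''D'' (RMul (RSub (rvar ''nA'') (rvar ''nB'')) (RSub (RRead ''K'' (nvar ''j'')) (rvar ''th''))) ;;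
    Cond (BAnd (BNot (RLess (rvar ''nA'') (rvar ''q''))) (RLess (rvar ''Gamma'') (RAdd (rvar ''G'') (rvar ''D''))))
      (rset ''th'' (RAdd (rvar ''th'')
         (RDiv (RSub (rvar ''Gamma'') (rvar ''G'')) (RSub (rvar ''nA'') (rvar ''nB'')))) ;;
       rset ''G'' (rvar ''Gamma''))
      (rset ''th'' (RRead ''K'' (nvar ''j'')) ;;
       rset ''G'' (RAdd (rvar ''G'') (rvar ''D'')) ;;
       Cond (NLess (nvar ''n'') (nvar ''j''))
         (rset ''nB'' (RAdd (rvar ''nB'') (RRead ''W'' (nvar ''j''))))
         (rset ''nA'' (RAdd (rvar ''nA'') (RRead ''W'' (nvar ''j'')))) ;;
       incr ''k'')"

definition sweep_guard :: bexp where
  "sweep_guard =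
    BAnd (BNot (BAnd (BNot (RLess (rvar ''nB'') (rvar ''q''))) (BNot (RLess (rvar ''Gamma'') (rvar ''G'')))))
      (BNot (BAnd (BNot (RLess (rvar ''nA'') (rvar ''q''))) (BNot (RLess (rvar ''G'') (rvar ''Gamma'')))))"

definition sweep :: com where
  "sweep = nset ''k'' (NConst 0) ;; While sweep_guard sweep_step"

text \<open>\<open>D\<close> first holds the raise, namely the gain in the clipped form of
  \<open>gain_eq\<close>, cut to the remaining budget; then it holds the hinge of the raised cost.
  The value is thus accumulated as the dual value, and no cheapest completion is computed.\<close>

definition emit_step :: com where
  "emit_step =
    incr ''k'' ;;
    rset ''D'' (RMul (RRead ''W'' (nvar ''k'')) (RSub (rvar ''th'') (RRead ''K'' (nvar ''k'')))) ;;
    rmax ''D'' RZero ;;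
    rmin ''D'' (RSub (RRead ''K'' (NAdd (nvar ''n'') (nvar ''k''))) (RRead ''K'' (nvar ''k''))) ;;
    rmin ''D'' (rvar ''rem'') ;;
    rset ''rem'' (RSub (rvar ''rem'') (rvar ''D'')) ;;
    RWrite ''c'' (nvar ''k'') (RAdd (RRead ''K'' (nvar ''k'')) (rvar ''D'')) ;;
    rset ''D'' (RMul (RRead ''W'' (nvar ''k'')) (RSub (rvar ''th'') (RRead ''c'' (nvar ''k'')))) ;;
    rmax ''D'' RZero ;;
    rset ''value'' (RSub (rvar ''value'') (rvar ''D''))"

definition emit :: com where
  "emit =
    rset ''rem'' (rvar ''Gamma'') ;;
    rset ''value'' (RMul (rvar ''q'') (rvar ''th'')) ;;
    nset ''k'' (NConst 0) ;;
    While (NLess (nvar ''k'') (nvar ''n'')) emit_step"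

definition solver :: com where
  "solver = load ;; merge_sort ;; sweep ;; emit"

context a2st
begin

section \<open>Verification of the program stages\<close>

text \<open>The weights are stored twice, so that the weight of a key is read at the index of the
  key, whether it is a lower or an upper cost.\<close>

definition loaded :: "state \<Rightarrow> bool" where
  "loaded s \<longleftrightarrow> nmem s ''n'' 0 = n \<and> rmem s ''q'' 0 = q \<and> rmem s ''Gamma'' 0 = \<Gamma> \<and>
    (\<forall>i\<in>{1..n}. rmem s ''K'' i = cl i \<and> rmem s ''K'' (n + i) = cu i \<and>
      rmem s ''W'' i = w i \<and> rmem s ''W'' (n + i) = w i)"

lemma loaded_key: "loaded s \<Longrightarrow> j \<in> {1..n + n} \<Longrightarrow> rmem s ''K'' j = key j"
proof (cases "j \<le> n")
  case False
  assume "loaded s" "j \<in> {1..n + n}"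
  moreover from this False have "j - n \<in> {1..n}" "n + (j - n) = j" by auto
  ultimately show ?thesis using False by (metis key_def loaded_def)
qed (auto simp: loaded_def key_def)

text \<open>As \<open>p \<le> n\<close>, adding 1 for each index up to \<open>p\<close> during the
  loop over all items accumulates exactly \<open>p\<close> as a real number.\<close>

lemma sum_indicator_le: "(\<Sum>i=1..n. if i \<le> p then 1 else 0 :: real) = p"
proof -
  have "{1..n} \<inter> {i. i \<le> p} = {1..p}" using p by auto
  then show ?thesis by (simp add: sum.If_cases)
qed

definition load_inv :: "state \<Rightarrow> bool" where
  "load_inv s \<longleftrightarrow> nmem s ''n'' 0 = n \<and> nmem s ''p'' 0 = p \<and> (\<forall>i\<in>{1..n}. nmem s ''x'' i = x i) \<and>
    nmem s ''N'' 0 = n + n \<and> nmem s ''k'' 0 \<le> n \<and>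
    (\<forall>j<nmem s ''k'' 0. nmem s ''P'' j = Suc j \<and> nmem s ''P'' (n + j) = n + Suc j) \<and>
    (\<forall>i\<in>{1..n}. rmem s ''cl'' i = cl i \<and> rmem s ''cu'' i = cu i) \<and>
    (\<forall>i\<in>{1..nmem s ''k'' 0}. rmem s ''K'' i = cl i \<and> rmem s ''K'' (n + i) = cu i \<and>
      rmem s ''W'' i = w i \<and> rmem s ''W'' (n + i) = w i) \<and>
    rmem s ''q'' 0 = (\<Sum>i=1..nmem s ''k'' 0. (if i \<le> p then 1 else 0) - real (x i)) \<and>
    rmem s ''Gamma'' 0 = \<Gamma> \<and> (\<forall>v\<in>{''th'', ''G'', ''nA'', ''nB''}. rmem s v 0 = 0)"

lemma load_correct:
  "wp load (input_state n p x cl cu \<Gamma>) (\<lambda>t s. loaded s \<and> nmem s ''N'' 0 = n + n \<and>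
    nmem s ''P'' ` {..<n + n} = {1..n + n} \<and> (\<forall>v\<in>{''th'', ''G'', ''nA'', ''nB''}. rmem s v 0 = 0) \<and>
    t \<le> 200 * n + 50)"
  unfolding load_def wp_Seq[of "nset ''N'' _"] wp_NWrite
proof (rule wp_While[where I = load_inv and V = "\<lambda>s. 200 * (n - nmem s ''k'' 0)"], goal_cases)
  case 1
  show ?case by (simp add: load_inv_def input_state_def)
next
  case (2 s)
  define k where "k = nmem s ''k'' 0"
  have k: "nmem s ''k'' 0 = k" by (simp add: k_def)
  from 2 have I: "nmem s ''n'' 0 = n" "nmem s ''p'' 0 = p" "\<forall>i\<in>{1..n}. nmem s ''x'' i = x i"
    "nmem s ''N'' 0 = n + n" "k < n"
    "\<forall>j<k. nmem s ''P'' j = Suc j \<and> nmem s ''P'' (n + j) = n + Suc j"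
    "\<forall>i\<in>{1..n}. rmem s ''cl'' i = cl i \<and> rmem s ''cu'' i = cu i"
    "\<forall>i\<in>{1..k}. rmem s ''K'' i = cl i \<and> rmem s ''K'' (n + i) = cu i \<and>
      rmem s ''W'' i = w i \<and> rmem s ''W'' (n + i) = w i"
    "rmem s ''q'' 0 = (\<Sum>i=1..k. (if i \<le> p then 1 else 0) - real (x i))"
    "rmem s ''Gamma'' 0 = \<Gamma>" "\<forall>v\<in>{''th'', ''G'', ''nA'', ''nB''}. rmem s v 0 = 0"
    by (auto simp: load_inv_def k_def)
  have mem: "Suc k \<in> {1..n}" using \<open>k < n\<close> by simp
  have here: "nmem s ''x'' (Suc k) = x (Suc k)" "rmem s ''cl'' (Suc k) = cl (Suc k)"
    "rmem s ''cu'' (Suc k) = cu (Suc k)"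
    using I mem by blast+
  have post: "load_inv s'"
    if P: "nmem s' ''P'' = (nmem s ''P'')(k := Suc k, n + k := n + Suc k)"
      and K: "rmem s' ''K'' = (rmem s ''K'')(Suc k := cl (Suc k), n + Suc k := cu (Suc k))"
      and W: "rmem s' ''W'' = (rmem s ''W'')(Suc k := w (Suc k), n + Suc k := w (Suc k))"
      and q': "rmem s' ''q'' 0 = rmem s ''q'' 0 + (if Suc k \<le> p then 1 else 0) - real (x (Suc k))"
      and k': "nmem s' ''k'' 0 = Suc k"
      and rest: "\<forall>v\<in>{''n'', ''p'', ''x'', ''N''}. nmem s' v = nmem s v"
        "\<forall>v\<in>{''cl'', ''cu'', ''Gamma'', ''th'', ''G'', ''nA'', ''nB''}. rmem s' v = rmem s v" for s'
  proof -
    have "nmem s' ''P'' j = Suc j \<and> nmem s' ''P'' (n + j) = n + Suc j" if "j < Suc k" for j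
      using that I(5,6) by (cases "j = k") (simp_all add: P)
    moreover have "rmem s' ''K'' i = cl i \<and> rmem s' ''K'' (n + i) = cu i \<and>
        rmem s' ''W'' i = w i \<and> rmem s' ''W'' (n + i) = w i" if "i \<in> {1..Suc k}" for i
      using that I(5,8) by (cases "i = Suc k") (simp_all add: K W)
    moreover have "rmem s' ''q'' 0 = (\<Sum>i=1..Suc k. (if i \<le> p then 1 else 0) - real (x i))"
      using q' I(9) by simp
    ultimately show ?thesis
      using I rest unfolding load_inv_def k' by simp
  qed
  from x01[OF mem] show ?case
  proof
    assume x0: "x (Suc k) = 0"
    then have "w (Suc k) = 1" by (simp add: w_def)
    with x0 I(1,2,5) here show ?thesis
      by (simp add: k) (intro conjI impI; simp add: post)
  next
    assume x1: "x (Suc k) = 1"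
    then have "w (Suc k) = 0" by (simp add: w_def)
    with x1 I(1,2,5) here show ?thesis
      by (simp add: k) (intro conjI impI; simp add: post)
  qed
next
  case (3 t s)
  then have k: "nmem s ''k'' 0 = n" by (auto simp: load_inv_def)
  have "nmem s ''P'' j = Suc j" if "j < n + n" for j
  proof (cases "j < n")
    case True
    then show ?thesis using 3 k by (auto simp: load_inv_def)
  next
    case False
    then have "j - n < n" "j = n + (j - n)" using that by auto
    moreover have "\<forall>i<n. nmem s ''P'' (n + i) = n + Suc i" using 3 k by (simp add: load_inv_def)
    ultimately show ?thesis by (metis add_Suc_right)
  qed
  then have "nmem s ''P'' ` {..<n + n} = Suc ` {..<n + n}" by (intro image_cong) auto
  also have "\<dots> = {1..n + n}" by (simp add: image_Suc_lessThan)
  finally have P: "nmem s ''P'' ` {..<n + n} = {1..n + n}" .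
  have "rmem s ''q'' 0 = q"
    using 3 k sum_indicator_le by (simp add: load_inv_def q_def sum_subtractf)
  with 3 k P show ?case
    by (auto simp: load_inv_def loaded_def input_state_def)
qed

definition sweep_state :: "state \<Rightarrow> bool" where
  "sweep_state s \<longleftrightarrow> loaded s \<and> nmem s ''k'' 0 \<le> n + n \<and>
    nmem s ''P'' ` {..<n + n} = {1..n + n} \<and> key_sorted key (nmem s ''P'') 0 (n + n) \<and>
    (let S = nmem s ''P'' ` {..<nmem s ''k'' 0}; t = rmem s ''th'' 0 in
      sweep_inv S t \<and> rmem s ''nA'' 0 = weight_low S \<and> rmem s ''nB'' 0 = weight_high S \<and>
      rmem s ''G'' 0 = G t)"

lemma sweep_guard_iff:
  "sweep_state s \<Longrightarrow> bval sweep_guard s \<longleftrightarrow> \<not> sweep_done (nmem s ''P'' ` {..<nmem s ''k'' 0}) (rmem s ''th'' 0)"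
  by (auto simp: sweep_state_def sweep_guard_def sweep_done_def loaded_def Let_def)

text \<open>Each remaining key carries 200 units. The extra 200 while \<open>G\<close> is below the
  budget pay for the crossing step, which consumes no key.\<close>

definition sweep_potential :: "state \<Rightarrow> nat" where
  "sweep_potential s = 200 * ((n + n - nmem s ''k'' 0) + (if rmem s ''G'' 0 < \<Gamma> then 1 else 0))"

text \<open>The 100 spare units cover the loop test. In ordinary steps \<open>G\<close> does not
  decrease, so the indicator in the potential cannot come back.\<close>

lemma sweep_step_correct:
  assumes state: "sweep_state s" and guard: "bval sweep_guard s"
  shows "wp sweep_step s (\<lambda>t s'. sweep_state s' \<and> t + 100 + sweep_potential s' \<le> sweep_potential s)"
proof -
  define P k S j t where "P = nmem s ''P''" and "k = nmem s ''k'' 0" and "S = P ` {..<k}"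
    and "j = P k" and "t = rmem s ''th'' 0"
  have loaded: "loaded s" and P: "P ` {..<n + n} = {1..n + n}" and sorted: "key_sorted key P 0 (n + n)"
    and inv: "sweep_inv S t" and "k \<le> n + n"
    and vals: "rmem s ''nA'' 0 = weight_low S" "rmem s ''nB'' 0 = weight_high S" "rmem s ''G'' 0 = G t"
    using state by (auto simp: sweep_state_def Let_def P_def k_def S_def t_def)
  have running: "\<not> sweep_done S t"
    using guard sweep_guard_iff[OF state] by (simp add: S_def P_def k_def t_def)
  then have "S \<noteq> {1..n + n}" using sweep_done_all by metis
  with P \<open>k \<le> n + n\<close> have k: "k < n + n" by (cases "k = n + n") (auto simp: S_def)
  \<comment> \<open>\<open>P\<close> maps \<open>n + n\<close> positions onto \<open>n + n\<close>
    indices, so it is injective, and the key read next is not among those already passed.\<close>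
  have inj: "inj_on P {..<n + n}" using P by (intro eq_card_imp_inj_on) auto
  have j: "j \<in> {1..n + n}" using P k by (auto simp: j_def)
  have "j \<notin> S"
  proof
    assume "j \<in> S"
    then obtain i where "i < k" "P i = P k" by (auto simp: S_def j_def)
    then show False using inj k by (auto dest: inj_onD)
  qed
  have sep: "separates S (key j)"
    unfolding separates_def
  proof (intro conjI ballI)
    fix i assume "i \<in> S"
    then show "key i \<le> key j" using key_sortedD[OF sorted] k by (auto simp: S_def j_def)
  next
    fix i assume i: "i \<in> {1..n + n} - S"
    then obtain l where "l < n + n" "i = P l" using P by (auto simp: set_eq_iff image_iff)
    moreover from this i have "k \<le> l" by (force simp: S_def)
    ultimately show "key j \<le> key i" using key_sortedD[OF sorted] by (auto simp: j_def)
  qed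
  have sep_t: "separates S t" using inv by (simp add: sweep_inv_def)
  then have le: "t \<le> key j" using j \<open>j \<notin> S\<close> by (auto simp: separates_def)
  have Gj: "G (key j) = G t + (weight_low S - weight_high S) * (key j - t)"
    by (rule G_linear[OF sep_t sep le])
  have K: "rmem s ''K'' j = key j" by (rule loaded_key[OF loaded j])
  have regs: "P k = j" "nmem s ''k'' 0 = k" "rmem s ''th'' 0 = t" "nmem s ''P'' = P"
    "rmem s ''q'' 0 = q" "rmem s ''Gamma'' 0 = \<Gamma>" "nmem s ''n'' 0 = n"
    using loaded by (simp_all add: P_def k_def j_def t_def loaded_def)
  show ?thesis
  proof (cases "q \<le> weight_low S \<and> \<Gamma> < G (key j)")
    case True
    note cross = sweep_inv_crossing[OF inv running sep le conjunct1[OF True] conjunct2[OF True]]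
    \<comment> \<open>With \<open>q \<le> weight_low S\<close>, a running sweep cannot have reached
      the budget; so the indicator in the potential drops from 1 to 0.\<close>
    have "G t < \<Gamma>" using True running by (auto simp: sweep_done_def)
    with True cross loaded k P sorted show ?thesis
      by (simp add: sweep_step_def sweep_state_def sweep_potential_def Let_def regs vals K Gj[symmetric] loaded_def
          S_def[symmetric] not_less)
  next
    case False
    have next_inv: "sweep_inv (insert j S) (key j)"
      by (intro sweep_inv_insert sweep_inv_next[OF inv running sep le]) (use False in auto)
    have S': "P ` {..<Suc k} = insert j S" by (simp add: S_def j_def lessThan_Suc)
    have Gle: "G t \<le> G (key j)" by (rule G_mono[OF le])
    show ?thesis
    proof (cases "j \<le> n")
      case True
      then have "j \<in> {1..n}" using j by simp
      note wt = weight_insert_low[OF this \<open>j \<notin> S\<close>]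
      have "rmem s ''W'' j = w j" using loaded \<open>j \<in> {1..n}\<close> by (simp add: loaded_def)
      with True False next_inv wt Gle loaded k P sorted show ?thesis
        by (auto simp: sweep_step_def sweep_state_def sweep_potential_def Let_def regs vals K Gj[symmetric]
            loaded_def S' not_less)
    next
      case high: False
      define i where "i = j - n"
      have i: "i \<in> {1..n}" "j = n + i" using high j by (auto simp: i_def)
      note wt = weight_insert_high[OF i(1) \<open>j \<notin> S\<close>[unfolded i(2)], folded i(2)]
      have "rmem s ''W'' j = w i" using loaded i by (simp add: loaded_def)
      with high False next_inv wt Gle loaded k P sorted show ?thesis
        by (auto simp: sweep_step_def sweep_state_def sweep_potential_def Let_def regs vals K Gj[symmetric]
            loaded_def S' not_less)
    qed
  qed
qed

lemma sweep_correct: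
  assumes "loaded s" "nmem s ''P'' ` {..<n + n} = {1..n + n}" "key_sorted key (nmem s ''P'') 0 (n + n)"
    and "\<forall>v\<in>{''th'', ''G'', ''nA'', ''nB''}. rmem s v 0 = 0"
  shows "wp sweep s (\<lambda>t s'. loaded s' \<and> (\<forall>u. F u \<le> F (rmem s' ''th'' 0)) \<and> t \<le> 400 * n + 300)"
  unfolding sweep_def wp_Seq wp_NWrite
proof (rule wp_While[where I = sweep_state and V = sweep_potential], goal_cases)
  case 1
  have "gain i 0 = 0" if "i \<in> {1..n}" for i
    using costs[OF that] by (simp add: gain_def max_def)
  then have "G 0 = 0" by (simp add: G_def)
  moreover have "weight_low {} = 0" "weight_high {} = 0" by (simp_all add: weight_low_def weight_high_def)
  ultimately show ?case
    using assms sweep_inv_0 by (simp add: sweep_state_def loaded_def)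
next
  case (2 s')
  show ?case
    by (rule wp_mono[OF sweep_step_correct[OF 2]]) (simp add: sweep_guard_def)
next
  case (3 t s')
  then show ?case
    using sweep_guard_iff[of s'] sweep_done_optimal
    by (auto simp: sweep_state_def sweep_potential_def sweep_guard_def Let_def split: if_splits)
qed

text \<open>Greedy spending exhausts on every prefix either the budget or the gains. At
  \<open>k = n\<close> the closed form is the total demanded by
  \<open>optimal_scenario\<close>.\<close>

definition emit_inv :: "real \<Rightarrow> state \<Rightarrow> bool" where
  "emit_inv t s \<longleftrightarrow> loaded s \<and> rmem s ''th'' 0 = t \<and>
    (let k = nmem s ''k'' 0; c = rmem s ''c'' in
      k \<le> n \<and> (\<forall>i\<in>{1..k}. cl i \<le> c i \<and> c i - cl i \<le> gain i t) \<and>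
      (\<Sum>i=1..k. c i - cl i) = min \<Gamma> (\<Sum>i=1..k. gain i t) \<and>
      rmem s ''rem'' 0 = \<Gamma> - min \<Gamma> (\<Sum>i=1..k. gain i t) \<and>
      rmem s ''value'' 0 = q * t - (\<Sum>i=1..k. w i * max 0 (t - c i)))"

lemma gain_eq: "i \<in> {1..n} \<Longrightarrow> gain i t = min (max (w i * (t - cl i)) 0) (cu i - cl i)"
  using w01[of i] costs[of i] by (auto simp: gain_def max_def min_def)

lemma emit_step_correct:
  assumes inv: "emit_inv t s" and "nmem s ''k'' 0 < n"
  shows "wp emit_step s (\<lambda>u s'. emit_inv t s' \<and> u + 100 + 500 * (n - nmem s' ''k'' 0) \<le> 500 * (n - nmem s ''k'' 0))"
proof -
  define k i where "k = nmem s ''k'' 0" and "i = Suc k"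
  define r c where "r = rmem s ''rem'' 0" and "c = rmem s ''c''"
  define \<delta> where "\<delta> = min (gain i t) r"
  define c' where "c' = c(i := cl i + \<delta>)"
  define g where "g = (\<Sum>i=1..k. gain i t)"
  have loaded: "loaded s" and t: "rmem s ''th'' 0 = t"
    and c: "\<forall>i\<in>{1..k}. cl i \<le> c i \<and> c i - cl i \<le> gain i t"
    and total: "(\<Sum>i=1..k. c i - cl i) = min \<Gamma> g" and r: "r = \<Gamma> - min \<Gamma> g"
    and val: "rmem s ''value'' 0 = q * t - (\<Sum>i=1..k. w i * max 0 (t - c i))"
    using inv by (auto simp: emit_inv_def k_def r_def c_def g_def Let_def)
  have i: "i \<in> {1..n}" using assms(2) by (simp add: i_def k_def)
  have regs: "rmem s ''W'' i = w i" "rmem s ''K'' i = cl i" "rmem s ''K'' (n + i) = cu i"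
    "nmem s ''n'' 0 = n" "rmem s ''rem'' 0 = r" "nmem s ''k'' 0 = k" "Suc k = i" "rmem s ''c'' = c"
    using loaded i by (simp_all add: loaded_def) (simp_all add: r_def k_def i_def c_def)
  have decr: "n - k = Suc (n - i)" using i by (simp add: i_def)
  have "0 \<le> \<delta>" using gain_nonneg[OF i] r by (simp add: \<delta>_def)
  have c'_old: "c' l = c l" if "l \<in> {1..k}" for l using that by (simp add: c'_def i_def)
  have sums: "(\<Sum>l=1..i. f l (c' l)) = (\<Sum>l=1..k. f l (c l)) + f i (cl i + \<delta>)" for f :: "nat \<Rightarrow> real \<Rightarrow> real"
  proof -
    have "(\<Sum>l=1..k. f l (c' l)) = (\<Sum>l=1..k. f l (c l))" using c'_old by (intro sum.cong) auto
    then show ?thesis by (simp add: i_def c'_def)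
  qed
  have g': "(\<Sum>l=1..i. gain l t) = g + gain i t" by (simp add: i_def g_def)
  \<comment> \<open>The program truncates at 0 after multiplying by the weight, the dual function
    before; for weights 0 and 1 this agrees.\<close>
  have wmax: "w i * max 0 (t - (cl i + \<delta>)) = max (w i * (t - (cl i + \<delta>))) 0"
    using w01[OF i] by (auto simp: max_def)
  have post: "emit_inv t s'" if "loaded s'" "rmem s' ''th'' 0 = t" "nmem s' ''k'' 0 = i" "rmem s' ''c'' = c'"
    "rmem s' ''rem'' 0 = r - \<delta>"
    "rmem s' ''value'' 0 = rmem s ''value'' 0 - max (w i * (t - (cl i + \<delta>))) 0" for s'
  proof -
    have "\<forall>l\<in>{1..i}. cl l \<le> c' l \<and> c' l - cl l \<le> gain l t"
      using c \<open>0 \<le> \<delta>\<close> by (auto simp: i_def le_Suc_eq c'_def \<delta>_def)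
    moreover have "(\<Sum>l=1..i. c' l - cl l) = min \<Gamma> (g + gain i t)"
      using sums[of "\<lambda>l v. v - cl l"] total r gain_nonneg[OF i, of t] by (auto simp: \<delta>_def)
    moreover have "r - \<delta> = \<Gamma> - min \<Gamma> (g + gain i t)"
      using r gain_nonneg[OF i, of t] by (auto simp: \<delta>_def)
    moreover have "rmem s' ''value'' 0 = q * t - (\<Sum>l=1..i. w l * max 0 (t - c' l))"
      using that sums[of "\<lambda>l v. w l * max 0 (t - v)"] val wmax by simp
    ultimately show ?thesis using that i g' by (simp add: emit_inv_def Let_def)
  qed
  show ?thesis
    unfolding emit_step_def
    apply (simp add: regs t)
    apply (rule wp_rmax, simp add: regs t)
    apply (rule wp_rmin, simp add: regs t)
    apply (rule wp_rmin, simp add: regs t)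
    apply (rule wp_rmax, simp add: regs t)
    apply (intro conjI post)
    using loaded i by (simp_all add: decr loaded_def regs t gain_eq[OF i, symmetric] \<delta>_def[symmetric] c'_def)
qed

lemma emit_correct:
  assumes "loaded s" "\<And>u. F u \<le> F (rmem s ''th'' 0)"
  shows "wp emit s (\<lambda>t s'. is_arg_max (min_cost n p x) (\<lambda>c. c \<in> Uc n cl (\<lambda>i. cu i - cl i) \<Gamma>)
      (output_scenario n s') \<and> output_value s' = min_cost n p x (output_scenario n s') \<and>
    t \<le> 500 * n + 100)"
proof -
  let ?t = "rmem s ''th'' 0"
  show ?thesis
    unfolding emit_def wp_Seq wp_NWrite wp_RWrite
  proof (rule wp_While[where I = "emit_inv ?t" and V = "\<lambda>s. 500 * (n - nmem s ''k'' 0)"], goal_cases)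
    case 1
    show ?case using assms(1) budget by (simp add: emit_inv_def loaded_def)
  next
    case (2 s')
    then have "nmem s' ''k'' 0 < n" by (simp add: emit_inv_def loaded_def)
    from emit_step_correct[OF 2(1) this] show ?case by (rule wp_mono) simp
  next
    case (3 u s')
    then have k: "nmem s' ''k'' 0 = n" by (auto simp: emit_inv_def loaded_def Let_def)
    have "output_scenario n s' = restrict (rmem s' ''c'') {1..n}"
      by (simp add: output_scenario_def)
    moreover have "output_value s' = lagrangian (rmem s' ''c'') ?t"
      using 3 k by (simp add: output_value_def emit_inv_def lagrangian_def Let_def)
    ultimately show ?case
      using optimal_scenario[of ?t "rmem s' ''c''"] assms(2) 3 k
      by (simp add: emit_inv_def G_def Let_def)
  qed
qed

lemma solver_correct:
  "wp solver (input_state n p x cl cu \<Gamma>) (\<lambda>t s.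
    is_arg_max (min_cost n p x) (\<lambda>c. c \<in> Uc n cl (\<lambda>i. cu i - cl i) \<Gamma>) (output_scenario n s) \<and>
    output_value s = min_cost n p x (output_scenario n s) \<and>
    t \<le> 1200 * n + 500 + (700 * n + 100) * doublings 1 (n + n))"
  unfolding solver_def wp_Seq
proof (rule wp_mono[OF load_correct], elim conjE)
  fix t1 s1
  assume s1: "loaded s1" "nmem s1 ''N'' 0 = n + n" "nmem s1 ''P'' ` {..<n + n} = {1..n + n}"
    "\<forall>v\<in>{''th'', ''G'', ''nA'', ''nB''}. rmem s1 v 0 = 0" and t1: "t1 \<le> 200 * n + 50"
  show "wp merge_sort s1 (\<lambda>t2 s2. wp sweep s2 (\<lambda>t3 s3. wp emit s3 (\<lambda>t4 s.
      is_arg_max (min_cost n p x) (\<lambda>c. c \<in> Uc n cl (\<lambda>i. cu i - cl i) \<Gamma>) (output_scenario n s) \<and>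
      output_value s = min_cost n p x (output_scenario n s) \<and>
      t1 + (t2 + (t3 + t4)) \<le> 1200 * n + 500 + (700 * n + 100) * doublings 1 (n + n))))"
  proof (rule wp_mono[OF merge_sort_correct], unfold s1(2,3), elim conjE)
    fix t2 s2
    assume unch: "unchanged_except {''P'', ''Q'', ''a'', ''b'', ''k'', ''i'', ''mid'', ''hi'', ''w''} s1 s2"
      and P: "nmem s2 ''P'' ` {..<n + n} = {1..n + n}"
      and sorted: "key_sorted (rmem s1 ''K'') (nmem s2 ''P'') 0 (n + n)"
      and t2: "t2 \<le> (350 * (n + n) + 100) * doublings 1 (n + n) + 20"
    have s2: "loaded s2" "\<forall>v\<in>{''th'', ''G'', ''nA'', ''nB''}. rmem s2 v 0 = 0"
      using s1 unchanged_exceptD[OF unch] by (simp_all add: loaded_def)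
    have "rmem s1 ''K'' (nmem s2 ''P'' i) = key (nmem s2 ''P'' i)" if "i < n + n" for i
      using that P by (intro loaded_key[OF s1(1)]) auto
    with sorted have "key_sorted key (nmem s2 ''P'') 0 (n + n)"
      by (simp add: key_sorted_def)
    from sweep_correct[OF s2(1) P this s2(2)]
    show "wp sweep s2 (\<lambda>t3 s3. wp emit s3 (\<lambda>t4 s.
      is_arg_max (min_cost n p x) (\<lambda>c. c \<in> Uc n cl (\<lambda>i. cu i - cl i) \<Gamma>) (output_scenario n s) \<and>
      output_value s = min_cost n p x (output_scenario n s) \<and>
      t1 + (t2 + (t3 + t4)) \<le> 1200 * n + 500 + (700 * n + 100) * doublings 1 (n + n)))"
    proof (rule wp_mono, elim conjE)
      fix t3 s3
      assume s3: "loaded s3" "\<forall>u. F u \<le> F (rmem s3 ''th'' 0)" and t3: "t3 \<le> 400 * n + 300"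
      have "350 * (n + n) + 100 = 700 * n + 100" by simp
      with t2 have t2': "t2 \<le> (700 * n + 100) * doublings 1 (n + n) + 20" by metis
      show "wp emit s3 (\<lambda>t4 s.
        is_arg_max (min_cost n p x) (\<lambda>c. c \<in> Uc n cl (\<lambda>i. cu i - cl i) \<Gamma>) (output_scenario n s) \<and>
        output_value s = min_cost n p x (output_scenario n s) \<and>
        t1 + (t2 + (t3 + t4)) \<le> 1200 * n + 500 + (700 * n + 100) * doublings 1 (n + n))"
        using t1 t2' t3 by (intro wp_mono[OF emit_correct[OF s3(1) s3(2)[rule_format]]]) auto
    qed
  qed
qed

end

section \<open>The asymptotic bound\<close>

text \<open>The constant 1700 is 1200 + 500, which also dominates the coefficients of the sorting
  term. The summand 2 comes from rounding the logarithm up and from the linear stages.\<close>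

lemma solver_bound:
  assumes "0 < n" "t \<le> 1200 * n + 500 + (700 * n + 100) * doublings 1 (n + n)"
  shows "real t \<le> 1700 * (real n + 1) * (log 2 (2 * real n) + 2)"
proof -
  let ?D = "doublings 1 (n + n)"
  have "1200 * n + 500 + (700 * n + 100) * ?D \<le> 1700 * (n + 1) * (?D + 1)"
    by (simp add: algebra_simps)
  with assms(2) have "t \<le> 1700 * (n + 1) * (?D + 1)" by linarith
  then have "real t \<le> real (1700 * (n + 1) * (?D + 1))" by (simp only: of_nat_le_iff)
  also have "\<dots> = 1700 * (real n + 1) * (real ?D + 1)"
    by (simp only: of_nat_mult of_nat_add of_nat_numeral of_nat_1)
  also have "\<dots> \<le> 1700 * (real n + 1) * (log 2 (2 * real n) + 2)"
    using doublings_1_le[of "n + n"] assms(1) by (intro mult_left_mono) auto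
  finally show ?thesis .
qed

theorem corollary25:
  "\<exists>(P :: com) (T :: nat \<Rightarrow> real).
     T \<in> O(\<lambda>n. real n * ln (real n)) \<and> solves_A2ST_within P T"
proof (intro exI conjI)
  \<comment> \<open>The Landau bound is eventual, so \<open>n = 1\<close>, where
    \<open>n * ln n\<close> vanishes, does no harm; the running time bound itself covers every
    \<open>n \<ge> 1\<close>.\<close>
  show "(\<lambda>n. 1700 * (real n + 1) * (log 2 (2 * real n) + 2)) \<in> O(\<lambda>n. real n * ln (real n))"
    by real_asymp
  show "solves_A2ST_within solver (\<lambda>n. 1700 * (real n + 1) * (log 2 (2 * real n) + 2))"
    unfolding solves_A2ST_within_def
  proof (intro allI impI)
    fix n p :: nat and x :: "nat \<Rightarrow> nat" and cl cu :: "nat \<Rightarrow> real" and \<Gamma> :: real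
    assume "p \<in> {1..n}" "x \<in> Phi1 n p" "\<forall>i\<in>{1..n}. 0 \<le> cl i \<and> cl i \<le> cu i" "0 \<le> \<Gamma>"
    then interpret a2st n p x cl cu \<Gamma> by unfold_locales auto
    have "0 < n" using p by auto
    from solver_correct solver_bound[OF this]
    show "\<exists>t s. exec solver (input_state n p x cl cu \<Gamma>) t s \<and>
        real t \<le> 1700 * (real n + 1) * (log 2 (2 * real n) + 2) \<and>
        is_arg_max (min_cost n p x) (\<lambda>c. c \<in> Uc n cl (\<lambda>i. cu i - cl i) \<Gamma>) (output_scenario n s) \<and>
        output_value s = min_cost n p x (output_scenario n s)"
      unfolding wp_def by blast
  qed
qed

end
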